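(* Let $p_0,p_1,p_2\ge0$ with $p:=p_0+p_1+p_2\le1$, let $(B_0,B_1,B_2)$ be the multinomial process with parameters $p_0,p_1,p_2$, and let $$S_1(t)=\sum_{i=0}^{B_1(t)}Y_{1i}+\sum_{i=0}^{B_0(t)}Y_{3i},\qquad S_2(t)=\sum_{i=0}^{B_2(t)}Y_{2i}+\sum_{i=0}^{B_0(t)}Y_{4i},$$ with claim sizes $Y_{ki}$ as described in the context. Then for all $t$ the distribution of the time intersection $(S_1(t),S_2(t))$ of the bivariate process $(S_1,S_2)$ is determined by the Laplace–Stieltjes transform $$\mathbb{E}e^{-z_1S_1(t)-z_2S_2(t)}=\left[1-p+p_1\mathbb{E}e^{-z_1Y_{11}}+p_0\mathbb{E}e^{-(z_1Y_{31}+z_2Y_{41})}+p_2\mathbb{E}e^{-z_2Y_{21}}\right]^t.$$ Moreover: (i) If $\mathbb{E}Y_{i1}<\infty$, $i=1,2,3,4$, then $\mathbb{E}(S_1(t))=t(p_1\mathbb{E}Y_{11}+p_0\mathbb{E}Y_{31})$ and $\mathbb{E}(S_2(t))=t(p_2\mathbb{E}Y_{21}+p_0\mathbb{E}Y_{41})$. (ii) If $\mathbb{E}(Y_{i1}^2)<\infty$, $i=1,2,3,4$, then $$\mathbb{D}(S_1(t))=t\left[p_1\mathbb{E}(Y_{11}^2)+p_0\mathbb{E}(Y_{31}^2)-(p_1\mathbb{E}Y_{11}+p_0\mathbb{E}Y_{31})^2\right],$$ $$\mathbb{D}(S_2(t))=t\left[p_2\mathbb{E}(Y_{21}^2)+p_0\mathbb{E}(Y_{41}^2)-(p_2\mathbb{E}Y_{21}+p_0\mathbb{E}Y_{41})^2\right].$$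 (iii) $\mathbb{E}(S_1(t)S_2(t))=tp_0\mathbb{E}(Y_{31}Y_{41})+t(t-1)(p_1\mathbb{E}Y_{11}+p_0\mathbb{E}Y_{31})(p_2\mathbb{E}Y_{21}+p_0\mathbb{E}Y_{41})$. (iv) $\mathrm{cov}(S_1(t),S_2(t))=t\left[p_0\mathbb{E}(Y_{31}Y_{41})-(p_1\mathbb{E}Y_{11}+p_0\mathbb{E}Y_{31})(p_2\mathbb{E}Y_{21}+p_0\mathbb{E}Y_{41})\right]$. (v) The correlation $\mathrm{cor}(S_1(t),S_2(t))$ does not depend on $t$. More precisely, $$\mathrm{cor}(S_1(t),S_2(t))=\frac{p_0\mathbb{E}(Y_{31}Y_{41})-(p_1\mathbb{E}Y_{11}+p_0\mathbb{E}Y_{31})(p_2\mathbb{E}Y_{21}+p_0\mathbb{E}Y_{41})}{\sqrt{\left[p_1\mathbb{E}(Y_{11}^2)+p_0\mathbb{E}(Y_{31}^2)-(p_1\mathbb{E}Y_{11}+p_0\mathbb{E}Y_{31})^2\right]\left[p_2\mathbb{E}(Y_{21}^2)+p_0\mathbb{E}(Y_{41}^2)-(p_2\mathbb{E}Y_{21}+p_0\mathbb{E}Y_{41})^2\right]}}.$$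
   Context: Time is discrete, $t=0,1,2,\dots$, and $\mathbb{D}$ denotes variance. The multinomial process with parameters $p_0,p_1,p_2$ is the process $(B_0,B_1,B_2)$ starting at $(0,0,0)$, with independent and homogeneous additive increments, whose one-time distributions are $$\mathbb{P}(B_0(t)=b_0,B_1(t)=b_1,B_2(t)=b_2)=\frac{t!}{b_0!\,b_1!\,b_2!\,(t-b_0-b_1-b_2)!}p_0^{b_0}p_1^{b_1}p_2^{b_2}(1-p)^{t-b_0-b_1-b_2}$$ for $b_0,b_1,b_2\in\{0,\dots,t\}$ with $b_0+b_1+b_2\le t$, and $0$ otherwise. Claim sizes: the $Y_{ki}$ ($k=1,2,3,4$, $i\ge1$) are integer-valued with $\mathbb{P}(Y_{ki}>0)=1$; $\{Y_{1i}\}_{i\ge1}$ are i.i.d., $\{Y_{2i}\}_{i\ge1}$ are i.i.d., the pairs $\{(Y_{3i},Y_{4i})\}_{i\ge1}$ are i.i.d. ($Y_{3i}$ and $Y_{4i}$ may be dependent); these three sequences are mutually independent and independent of $(B_0,B_1,B_2)$; $Y_{k0}=0$. *)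

theory Defs
  imports "HOL-Probability.Probability"
begin

context prob_space
begin

text \<open>
  The \<open>\<sigma>\<close>-algebra on the sample space generated by a whole sequence \<open>(X n)\<close>, i.e. by
  the sequence regarded as one random element of the product space.
\<close>

definition generated_sigma :: "(nat \<Rightarrow> 'a \<Rightarrow> 'b) \<Rightarrow> 'a set set" where
  "generated_sigma X =
     sets (vimage_algebra (space M) (\<lambda>\<omega> n. X n \<omega>) (PiM UNIV (\<lambda>_. count_space UNIV)))"

definition independent_increments :: "(nat \<Rightarrow> 'a \<Rightarrow> 'b::ab_group_add) \<Rightarrow> bool" where
  "independent_increments X \<longleftrightarrow>
     (\<forall>n \<tau>. strict_mono_on {..n} \<tau> \<longrightarrow>
        indep_vars (\<lambda>_. count_space UNIV) (\<lambda>i \<omega>. X (\<tau> (Suc i)) \<omega> - X (\<tau> i) \<omega>) {..<n})"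

definition homogeneous_increments :: "(nat \<Rightarrow> 'a \<Rightarrow> 'b::ab_group_add) \<Rightarrow> bool" where
  "homogeneous_increments X \<longleftrightarrow>
     (\<forall>s t h. distr M (count_space UNIV) (\<lambda>\<omega>. X (s + h) \<omega> - X s \<omega>) =
              distr M (count_space UNIV) (\<lambda>\<omega>. X (t + h) \<omega> - X t \<omega>))"

text \<open>
  The counts are embedded into the integers before increments are formed, because
  subtraction of natural numbers is truncated.
\<close>

definition multinomial_process ::
  "real \<Rightarrow> real \<Rightarrow> real \<Rightarrow> (nat \<Rightarrow> 'a \<Rightarrow> nat) \<Rightarrow> (nat \<Rightarrow> 'a \<Rightarrow> nat) \<Rightarrow> (nat \<Rightarrow> 'a \<Rightarrow> nat) \<Rightarrow> bool" where
  "multinomial_process p0 p1 p2 B0 B1 B2 \<longleftrightarrow>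
     (\<forall>t. B0 t \<in> measurable M (count_space UNIV) \<and> B1 t \<in> measurable M (count_space UNIV) \<and>
          B2 t \<in> measurable M (count_space UNIV)) \<and>
     (AE \<omega> in M. B0 0 \<omega> = 0 \<and> B1 0 \<omega> = 0 \<and> B2 0 \<omega> = 0) \<and>
     independent_increments (\<lambda>t \<omega>. (int (B0 t \<omega>), int (B1 t \<omega>), int (B2 t \<omega>))) \<and>
     homogeneous_increments (\<lambda>t \<omega>. (int (B0 t \<omega>), int (B1 t \<omega>), int (B2 t \<omega>))) \<and>
     (\<forall>t b0 b1 b2.
        prob {\<omega> \<in> space M. B0 t \<omega> = b0 \<and> B1 t \<omega> = b1 \<and> B2 t \<omega> = b2} =
          (if b0 + b1 + b2 \<le> t
           then fact t / (fact b0 * fact b1 * fact b2 * fact (t - b0 - b1 - b2)) *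
                p0 ^ b0 * p1 ^ b1 * p2 ^ b2 * (1 - (p0 + p1 + p2)) ^ (t - b0 - b1 - b2)
           else 0))"

definition iid_from_1 :: "(nat \<Rightarrow> 'a \<Rightarrow> 'b) \<Rightarrow> bool" where
  "iid_from_1 X \<longleftrightarrow>
     indep_vars (\<lambda>_. count_space UNIV) X {1..} \<and>
     (\<forall>i\<ge>1. distr M (count_space UNIV) (X i) = distr M (count_space UNIV) (X 1))"

definition claim_sizes :: "(nat \<Rightarrow> nat \<Rightarrow> 'a \<Rightarrow> int) \<Rightarrow> bool" where
  "claim_sizes Y \<longleftrightarrow>
     (\<forall>k\<in>{1..4}. \<forall>i. Y k i \<in> measurable M (count_space UNIV)) \<and>
     (\<forall>k\<in>{1..4}. \<forall>\<omega>\<in>space M. Y k 0 \<omega> = 0) \<and>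
     (\<forall>k\<in>{1..4}. \<forall>i\<ge>1. prob {\<omega> \<in> space M. Y k i \<omega> > 0} = 1) \<and>
     iid_from_1 (Y 1) \<and> iid_from_1 (Y 2) \<and> iid_from_1 (\<lambda>i \<omega>. (Y 3 i \<omega>, Y 4 i \<omega>))"

text \<open>
  The counting process and the three claim-size sequences (the third one being the sequence
  of pairs) are mutually independent; each is independent as a whole sequence.
\<close>

definition claims_independent ::
  "(nat \<Rightarrow> 'a \<Rightarrow> nat) \<Rightarrow> (nat \<Rightarrow> 'a \<Rightarrow> nat) \<Rightarrow> (nat \<Rightarrow> 'a \<Rightarrow> nat) \<Rightarrow> (nat \<Rightarrow> nat \<Rightarrow> 'a \<Rightarrow> int) \<Rightarrow> bool" where
  "claims_independent B0 B1 B2 Y \<longleftrightarrow>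
     indep_sets
       (\<lambda>j. [generated_sigma (\<lambda>t \<omega>. (B0 t \<omega>, B1 t \<omega>, B2 t \<omega>)),
             generated_sigma (Y 1),
             generated_sigma (Y 2),
             generated_sigma (\<lambda>i \<omega>. (Y 3 i \<omega>, Y 4 i \<omega>))] ! j)
       {..<4}"

definition covariance :: "('a \<Rightarrow> real) \<Rightarrow> ('a \<Rightarrow> real) \<Rightarrow> real" where
  "covariance X Z = expectation (\<lambda>\<omega>. (X \<omega> - expectation X) * (Z \<omega> - expectation Z))"

definition correlation :: "('a \<Rightarrow> real) \<Rightarrow> ('a \<Rightarrow> real) \<Rightarrow> real" where
  "correlation X Z = covariance X Z / sqrt (variance X * variance Z)"

end

end

theory Submission
  imports Defs
begin

text \<open>
  Conditioning on the counts and summing with the multinomial theorem shows that the Laplace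
  transform of \<open>(S1 t, S2 t)\<close> is the \<open>t\<close>-th power of the transform at time 1. A law on the
  quadrant is determined by its Laplace transform: \<open>(x, y) \<mapsto> (exp (-x), exp (-y))\<close> turns integer
  points of the transform into moments on the unit square, where Stone--Weierstrass applies.
  So \<open>(S1 t, S2 t)\<close> is distributed like a sum of \<open>t\<close> independent copies of \<open>(S1 1, S2 1)\<close>, which
  is a mixture of \<open>(0, 0)\<close>, \<open>(Y 1 1, 0)\<close>, \<open>(Y 3 1, Y 4 1)\<close> and \<open>(0, Y 2 1)\<close>. All moments
  follow by induction on the number of summands; computing them as nonnegative integrals
  yields integrability as a by-product.
\<close>

text \<open>Expectations are computed in [0, \<infinity>] first: there Tonelli and the product rule
  for independent variables need no integrability, so the transform identity and the recursion for
  moments hold unconditionally, and finiteness enters only when passing to real expectations. The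
  price is that \<open>ennreal\<close> sends negative reals to 0. Coordinates are therefore additive
  under \<open>ennreal\<close> only on the quadrant, and a predicate closed under addition is
  carried along with the convolution powers to stay inside it. The detour through the law avoids two
  computations: differentiating the transform at the boundary point 0, where limits are one-sided
  and need domination, and expanding second moments of random sums over three dependent counts. Once
  the law at time \<open>t\<close> is a convolution power, only time 1 needs a case analysis, with
  four possible triples of counts.\<close>

section \<open>Uniqueness of a law on the quadrant with a given Laplace transform\<close>

text \<open>Closed sets generate the Borel sets and are stable under intersection, and the indicator
  of a closed set is a pointwise limit of continuous functions with values in [0, 1]. This leaves
  only continuous test functions to be approximated by polynomials.\<close>

lemma measure_eqI_continuous:
  fixes M N :: "'a::metric_space measure"
  assumes "finite_measure M" "finite_measure N"
    and sets: "sets M = sets borel" "sets N = sets borel"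
    and eq: "\<And>f::'a \<Rightarrow> real. continuous_on UNIV f \<Longrightarrow> (\<And>x. f x \<in> {0..1}) \<Longrightarrow>
               integral\<^sup>L M f = integral\<^sup>L N f"
  shows "M = N"
proof (rule measure_eqI_generator_eq[where \<Omega> = UNIV and E = "Collect closed" and A = "\<lambda>_. UNIV"])
  interpret M: finite_measure M by fact
  interpret N: finite_measure N by fact
  note [measurable_cong] = sets
  fix C :: "'a set" assume "C \<in> Collect closed"
  then have C: "closed C" by simp
  have "measure M C = measure N C"
  proof (cases "C = {}")
    case False
    \<comment> \<open>Equal to 1 on \<open>C\<close> and to 0 at distance at least 1 / n from it.
      The empty set is split off because \<open>infdist\<close> to it is 0 by convention, which
      would make every \<open>f n\<close> constantly 1.\<close>
    define f where "f n x = max 0 (1 - real n * infdist x C)" for n x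
    have cont: "continuous_on UNIV (f n)" for n
      unfolding f_def by (intro continuous_intros)
    have range: "f n x \<in> {0..1}" for n x
      by (auto simp: f_def infdist_nonneg)
    have meas: "f n \<in> borel_measurable borel" for n
      using cont by (rule borel_measurable_continuous_onI)
    have lim: "(\<lambda>n. f n x) \<longlonglongrightarrow> indicator C x" for x
    proof (cases "x \<in> C")
      case True
      then show ?thesis by (simp add: f_def)
    next
      case out: False
      have pos: "infdist x C > 0"
        using infdist_pos_not_in_closed C False out by blast
      obtain m :: nat where m: "real m * infdist x C > 1"
        using reals_Archimedean3[OF pos] by blast
      have "f n x = 0" if "n \<ge> m" for n
      proof -
        have "real m * infdist x C \<le> real n * infdist x C"
          using that pos by (intro mult_right_mono) auto
        then show ?thesis using m by (simp add: f_def)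
      qed
      then have "eventually (\<lambda>n. f n x = 0) sequentially"
        by (auto simp: eventually_sequentially)
      then show ?thesis using out by (simp add: tendsto_eventually)
    qed
    have conv: "(\<lambda>n. integral\<^sup>L P (f n)) \<longlonglongrightarrow> measure P C"
      if "finite_measure P" "sets P = sets borel" for P
    proof -
      interpret P: finite_measure P by fact
      note [measurable_cong] = that(2)
      have [measurable]: "C \<in> sets borel" using C by auto
      have "(\<lambda>n. integral\<^sup>L P (f n)) \<longlonglongrightarrow> integral\<^sup>L P (indicator C)"
        using range lim meas
        by (intro integral_dominated_convergence[where w = "\<lambda>_. 1"]) auto
      then show ?thesis by simp
    qed
    have "(\<lambda>n. integral\<^sup>L M (f n)) = (\<lambda>n. integral\<^sup>L N (f n))"
      using eq[OF cont range] by simp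
    then show ?thesis
      using conv[OF assms(1) sets(1)] conv[OF assms(2) sets(2)] LIMSEQ_unique by metis
  qed simp
  then show "emeasure M C = emeasure N C"
    by (simp add: M.emeasure_eq_measure N.emeasure_eq_measure)
next
  show "emeasure M UNIV \<noteq> \<infinity>"
    using finite_measure.emeasure_finite[OF assms(1)] by simp
qed (auto simp: Int_stable_def sets borel_eq_closed)

text \<open>Real polynomials in two variables, generated by linear operations only: an integral
  respects sums and scalar multiples, so equality of moments passes to the whole span by induction.
  Closure under products, which Stone--Weierstrass requires, is proved separately.\<close>

inductive_set monomial_span :: "(real \<times> real \<Rightarrow> real) set" where
  monomial: "(\<lambda>x. fst x ^ m * snd x ^ n) \<in> monomial_span"
| add: "f \<in> monomial_span \<Longrightarrow> g \<in> monomial_span \<Longrightarrow> (\<lambda>x. f x + g x) \<in> monomial_span"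
| scale: "f \<in> monomial_span \<Longrightarrow> (\<lambda>x. c * f x) \<in> monomial_span"

lemma monomial_span_mult_monomial:
  "f \<in> monomial_span \<Longrightarrow> (\<lambda>x. f x * (fst x ^ m * snd x ^ n)) \<in> monomial_span"
proof (induction rule: monomial_span.induct)
  case (monomial k l)
  have "(\<lambda>x::real\<times>real. fst x ^ (k + m) * snd x ^ (l + n)) \<in> monomial_span"
    by (rule monomial_span.monomial)
  then show ?case by (simp add: power_add mult_ac)
next
  case (add f g)
  then show ?case using monomial_span.add[OF add.IH] by (simp add: distrib_right)
next
  case (scale f c)
  then show ?case using monomial_span.scale[OF scale.IH] by (simp add: mult.assoc)
qed

text \<open>Induction on \<open>g\<close>: linearity leaves the case of a single monomial factor,
  which is \<open>monomial_span_mult_monomial\<close>.\<close>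

lemma monomial_span_mult: "g \<in> monomial_span \<Longrightarrow> f \<in> monomial_span \<Longrightarrow> (\<lambda>x. f x * g x) \<in> monomial_span"
proof (induction rule: monomial_span.induct)
  case (monomial k l)
  then show ?case by (rule monomial_span_mult_monomial)
next
  case (add g h)
  then show ?case using monomial_span.add[OF add.IH] by (simp add: distrib_left)
next
  case (scale g c)
  then show ?case using monomial_span.scale[OF scale.IH] by (simp add: mult.left_commute)
qed

lemma monomial_span_continuous: "f \<in> monomial_span \<Longrightarrow> continuous_on S f"
  by (induction rule: monomial_span.induct) (auto intro!: continuous_intros)

lemma function_ring_monomial_span: "compact S \<Longrightarrow> function_ring_on monomial_span S"
proof
  show "(\<lambda>_. c) \<in> monomial_span" for c
    using monomial_span.scale[OF monomial_span.monomial[of 0 0], of c] by simp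
  show "\<exists>f\<in>monomial_span. f x \<noteq> f y" if "x \<noteq> y" for x y
  proof -
    have "fst x \<noteq> fst y \<or> snd x \<noteq> snd y" using that by (auto simp: prod_eq_iff)
    moreover have "fst \<in> monomial_span" "snd \<in> monomial_span"
      using monomial_span.monomial[of 1 0] monomial_span.monomial[of 0 1] by simp_all
    ultimately show ?thesis by blast
  qed
qed (auto intro: monomial_span_continuous monomial_span.add monomial_span_mult)

text \<open>On the compact square a continuous function is within e / 2 of some polynomial. The
  polynomial has the same integral under both laws, and replacing \<open>f\<close> by it costs at
  most e / 2 under each, since the total mass is 1.\<close>

lemma moments_unit_square_unique:
  fixes M N :: "(real \<times> real) measure"
  assumes M: "prob_space M" and N: "prob_space N"
    and sets: "sets M = sets borel" "sets N = sets borel"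
    and supp: "AE x in M. x \<in> {0..1} \<times> {0..1}" "AE x in N. x \<in> {0..1} \<times> {0..1}"
    and eq: "\<And>m n. (\<integral>x. fst x ^ m * snd x ^ n \<partial>M) = (\<integral>x. fst x ^ m * snd x ^ n \<partial>N)"
  shows "M = N"
proof (rule measure_eqI_continuous)
  interpret M: prob_space M by fact
  interpret N: prob_space N by fact
  note [measurable_cong] = sets
  let ?K = "{0..1} \<times> {0..1} :: (real \<times> real) set"
  have K: "compact ?K" by (intro compact_Times compact_Icc)
  show "finite_measure M" "finite_measure N" by unfold_locales
  \<comment> \<open>Polynomials are unbounded on the plane; integrability comes from compactness of
    the square that carries the measure.\<close>
  have int: "integrable P f" if P: "prob_space P" "sets P = sets borel" "AE x in P. x \<in> ?K"
    and f: "continuous_on UNIV f" for P and f :: "real \<times> real \<Rightarrow> real"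
  proof -
    interpret P: prob_space P by fact
    have "bounded (f ` ?K)"
      using f K by (meson compact_continuous_image compact_imp_bounded continuous_on_subset subset_UNIV)
    then obtain B where "\<And>x. x \<in> ?K \<Longrightarrow> norm (f x) \<le> B"
      by (auto simp: bounded_iff)
    moreover have "f \<in> borel_measurable P"
      using borel_measurable_continuous_onI[OF f] P(2) measurable_cong_sets by blast
    ultimately show ?thesis
      using P(3) by (intro P.integrable_const_bound[where B = B]) auto
  qed
  have span: "integral\<^sup>L M g = integral\<^sup>L N g" if "g \<in> monomial_span" for g
    using that
  proof (induction rule: monomial_span.induct)
    case (add f g)
    then show ?case
      using int[OF M sets(1) supp(1)] int[OF N sets(2) supp(2)] monomial_span_continuous by simp
  qed (simp_all add: eq)
  fix f :: "real \<times> real \<Rightarrow> real" assume f: "continuous_on UNIV f"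
  have "\<bar>integral\<^sup>L M f - integral\<^sup>L N f\<bar> \<le> e" if "e > 0" for e
  proof -
    interpret function_ring_on monomial_span ?K by (rule function_ring_monomial_span[OF K])
    obtain g where g: "g \<in> monomial_span" "\<And>x. x \<in> ?K \<Longrightarrow> \<bar>f x - g x\<bar> < e / 2"
      using Stone_Weierstrass_basic[of f "e / 2"] f \<open>e > 0\<close> continuous_on_subset
      by (metis half_gt_zero subset_UNIV)
    have close: "\<bar>integral\<^sup>L P f - integral\<^sup>L P g\<bar> \<le> e / 2"
      if P: "prob_space P" "sets P = sets borel" "AE x in P. x \<in> ?K" for P
    proof -
      interpret P: prob_space P by fact
      have I: "integrable P f" "integrable P g"
        using int[OF P] f monomial_span_continuous[OF g(1)] by auto
      have "\<bar>integral\<^sup>L P f - integral\<^sup>L P g\<bar> = \<bar>\<integral>x. f x - g x \<partial>P\<bar>"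
        using I by simp
      also have "\<dots> \<le> (\<integral>x. \<bar>f x - g x\<bar> \<partial>P)"
        by (rule integral_abs_bound)
      also have "\<dots> \<le> (\<integral>x. e / 2 \<partial>P)"
        using I P(3) g(2) by (intro integral_mono_AE) (auto intro: less_imp_le)
      finally show ?thesis by (simp add: P.prob_space)
    qed
    show ?thesis
      using close[OF M sets(1) supp(1)] close[OF N sets(2) supp(2)] span[OF g(1)] by linarith
  qed
  then have "\<bar>integral\<^sup>L M f - integral\<^sup>L N f\<bar> \<le> 0"
    by (rule field_le_epsilon) simp
  then show "integral\<^sup>L M f = integral\<^sup>L N f" by simp
qed (use sets in auto)

lemma Laplace_transform_unique:
  fixes M N :: "(real \<times> real) measure"
  assumes M: "prob_space M" and N: "prob_space N"
    and sets: "sets M = sets borel" "sets N = sets borel"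
    and supp: "AE x in M. 0 \<le> fst x \<and> 0 \<le> snd x" "AE x in N. 0 \<le> fst x \<and> 0 \<le> snd x"
    and eq: "\<And>a b. 0 \<le> a \<Longrightarrow> 0 \<le> b \<Longrightarrow>
      (\<integral>x. exp (- a * fst x - b * snd x) \<partial>M) = (\<integral>x. exp (- a * fst x - b * snd x) \<partial>N)"
  shows "M = N"
proof -
  note [measurable_cong] = sets
  define \<phi> :: "real \<times> real \<Rightarrow> real \<times> real" where "\<phi> x = (exp (- fst x), exp (- snd x))" for x
  define \<psi> :: "real \<times> real \<Rightarrow> real \<times> real" where "\<psi> x = (- ln (fst x), - ln (snd x))" for x
  have [measurable]: "\<phi> \<in> borel_measurable borel" "\<psi> \<in> borel_measurable borel"
    unfolding \<phi>_def \<psi>_def borel_prod[symmetric] by measurable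
  have \<phi>_mon: "fst (\<phi> x) ^ m * snd (\<phi> x) ^ n = exp (- real m * fst x - real n * snd x)" for x m n
    by (simp add: \<phi>_def exp_of_nat_mult[symmetric] exp_add[symmetric] algebra_simps)
  \<comment> \<open>\<open>\<psi>\<close> inverts \<open>\<phi>\<close> on the whole plane, because
    \<open>ln (exp x) = x\<close> for every real \<open>x\<close>; the values of \<open>ln\<close>
    off the positive reals never matter. Pushing forward along \<open>\<psi>\<close> recovers a law
    from its image under \<open>\<phi>\<close>.\<close>
  have inv: "distr (distr P borel \<phi>) borel \<psi> = P" if [measurable_cong]: "sets P = sets borel" for P
  proof -
    have "distr (distr P borel \<phi>) borel \<psi> = distr P borel (\<lambda>x. x)"
      by (subst distr_distr) (auto simp: \<phi>_def \<psi>_def o_def)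
    then show ?thesis by (simp add: distr_id2 that)
  qed
  have "distr M borel \<phi> = distr N borel \<phi>"
  proof (rule moments_unit_square_unique)
    show "prob_space (distr M borel \<phi>)" "prob_space (distr N borel \<phi>)"
      by (auto intro!: prob_space.prob_space_distr M N)
    have K: "closed ({0..1} \<times> {0..1} :: (real \<times> real) set)" by (intro closed_Times closed_atLeastAtMost)
    have [measurable]: "{0..1} \<times> {0..1} \<in> sets (borel :: (real \<times> real) measure)"
      using K by (rule borel_closed)
    show "AE x in distr M borel \<phi>. x \<in> {0..1} \<times> {0..1}"
      using supp(1) by (subst AE_distr_iff) (auto simp: \<phi>_def)
    show "AE x in distr N borel \<phi>. x \<in> {0..1} \<times> {0..1}"
      using supp(2) by (subst AE_distr_iff) (auto simp: \<phi>_def)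
    show "(\<integral>x. fst x ^ m * snd x ^ n \<partial>distr M borel \<phi>) = (\<integral>x. fst x ^ m * snd x ^ n \<partial>distr N borel \<phi>)"
      for m n
    proof -
      have "(\<lambda>x::real \<times> real. fst x ^ m * snd x ^ n) \<in> borel_measurable borel"
        by (intro borel_measurable_continuous_onI continuous_intros)
      then show ?thesis
        using eq[of m n] by (subst (1 2) integral_distr) (simp_all add: \<phi>_mon)
    qed
  qed simp_all
  then show ?thesis using inv sets by metis
qed

section \<open>Convolution powers and their moments\<close>

text \<open>The law of a sum of \<open>t\<close> independent variables with law \<open>N\<close>,
  defined on the level of laws so that no independent copies have to be constructed on a common
  space.\<close>

primrec convolution_power :: "nat \<Rightarrow> 'a::ordered_euclidean_space measure \<Rightarrow> 'a measure" where
  "convolution_power 0 N = return borel 0"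
| "convolution_power (Suc t) N = convolution (convolution_power t N) N"

context
  fixes N :: "'a::ordered_euclidean_space measure"
  assumes prob: "prob_space N" and sets_N: "sets N = sets borel"
begin

lemma sets_convolution_power: "sets (convolution_power t N) = sets borel"
  by (cases t) simp_all

lemma prob_space_convolution_power: "prob_space (convolution_power t N)"
proof (induction t)
  case 0
  show ?case by (simp add: prob_space_return)
next
  case (Suc t)
  interpret N: prob_space N by (rule prob)
  interpret Q: prob_space "convolution_power t N" by (rule Suc)
  interpret QN: pair_prob_space "convolution_power t N" N ..
  note [measurable_cong] = sets_convolution_power sets_N
  show ?case
    unfolding convolution_power.simps convolution_def by (intro QN.P.prob_space_distr) measurable
qed

text \<open>Meant for the quadrant: it keeps the region where the coordinates are additive under
  \<open>ennreal\<close> at full measure for every \<open>t\<close>.\<close>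

lemma AE_convolution_power:
  assumes [measurable]: "Measurable.pred borel P"
    and "AE x in N. P x" and "P 0" and add: "\<And>x y. P x \<Longrightarrow> P y \<Longrightarrow> P (x + y)"
  shows "AE x in convolution_power t N. P x"
proof (induction t)
  case 0
  have "AE x in return borel 0. P x"
    using \<open>P 0\<close> by (subst AE_return) simp_all
  then show ?case unfolding convolution_power.simps .
next
  case (Suc t)
  interpret N: prob_space N by (rule prob)
  interpret Q: prob_space "convolution_power t N" by (rule prob_space_convolution_power)
  interpret QN: pair_prob_space "convolution_power t N" N ..
  note [measurable_cong] = sets_convolution_power sets_N
  have "AE z in convolution_power t N \<Otimes>\<^sub>M N. P (fst z + snd z)"
  proof (rule QN.AE_pair_measure)
    show "AE x in convolution_power t N. AE y in N. P (fst (x, y) + snd (x, y))"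
      using Suc
    proof eventually_elim
      case (elim x)
      show ?case using \<open>AE x in N. P x\<close> by eventually_elim (simp add: add elim)
    qed
  qed measurable
  then show ?case
    unfolding convolution_power.simps convolution_def
    by (subst AE_distr_iff) (simp_all add: case_prod_unfold)
qed

lemma nn_integral_convolution_power_Suc:
  assumes "f \<in> borel_measurable borel"
  shows "(\<integral>\<^sup>+x. f x \<partial>convolution_power (Suc t) N) = (\<integral>\<^sup>+x. \<integral>\<^sup>+y. f (x + y) \<partial>N \<partial>convolution_power t N)"
  using prob prob_space_convolution_power assms
  by (simp add: nn_integral_convolution prob_space_def sets_N sets_convolution_power)

text \<open>Independence of the summands in transform form; \<open>f\<close> will be the Laplace
  kernel.\<close>

lemma nn_integral_convolution_power_multiplicative:
  assumes [measurable]: "f \<in> borel_measurable borel"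
    and "f 0 = 1" and mult: "\<And>x y. f (x + y) = f x * f y"
  shows "(\<integral>\<^sup>+x. f x \<partial>convolution_power t N) = (\<integral>\<^sup>+x. f x \<partial>N) ^ t"
proof (induction t)
  case 0
  show ?case using \<open>f 0 = 1\<close> by (simp add: nn_integral_return)
next
  case (Suc t)
  note [measurable_cong] = sets_convolution_power sets_N
  show ?case
    by (simp add: nn_integral_convolution_power_Suc mult nn_integral_cmult nn_integral_multc Suc mult.commute
        del: convolution_power.simps)
qed

text \<open>Additivity is demanded only on a set \<open>P\<close> of full measure, since
  \<open>\<lambda>x. ennreal (fst x)\<close> is additive on the quadrant but not on the plane.
  Infinite integrals are allowed.\<close>

lemma nn_integral_convolution_power_additive:
  assumes [measurable]: "f \<in> borel_measurable borel" "Measurable.pred borel P"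
    and P: "AE x in N. P x" "P 0" "\<And>x y. P x \<Longrightarrow> P y \<Longrightarrow> P (x + y)"
    and "f 0 = 0" and add: "\<And>x y. P x \<Longrightarrow> P y \<Longrightarrow> f (x + y) = f x + f y"
  shows "(\<integral>\<^sup>+x. f x \<partial>convolution_power t N) = of_nat t * (\<integral>\<^sup>+x. f x \<partial>N)"
proof (induction t)
  case 0
  show ?case using \<open>f 0 = 0\<close> by (simp add: nn_integral_return)
next
  case (Suc t)
  note [measurable_cong] = sets_convolution_power sets_N
  interpret N: prob_space N by (rule prob)
  interpret Q: prob_space "convolution_power t N" by (rule prob_space_convolution_power)
  have AE_t: "AE x in convolution_power t N. P x"
    by (rule AE_convolution_power) (fact | simp add: P)+
  have "(\<integral>\<^sup>+x. f x \<partial>convolution_power (Suc t) N) =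
      (\<integral>\<^sup>+x. \<integral>\<^sup>+y. f (x + y) \<partial>N \<partial>convolution_power t N)"
    by (intro nn_integral_convolution_power_Suc) simp
  also have "\<dots> = (\<integral>\<^sup>+x. \<integral>\<^sup>+y. f x + f y \<partial>N \<partial>convolution_power t N)"
  proof (rule nn_integral_cong_AE)
    show "AE x in convolution_power t N. (\<integral>\<^sup>+y. f (x + y) \<partial>N) = (\<integral>\<^sup>+y. f x + f y \<partial>N)"
      using AE_t
      by eventually_elim (use P(1) in \<open>auto intro!: nn_integral_cong_AE simp: add\<close>)
  qed
  also have "\<dots> = of_nat (Suc t) * (\<integral>\<^sup>+x. f x \<partial>N)"
    by (simp add: nn_integral_add N.emeasure_space_1 Q.emeasure_space_1 Suc distrib_right add.commute)
  finally show ?case .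
qed

text \<open>One more summand \<open>y\<close> adds to \<open>f x * g x\<close> the term
  \<open>f y * g y\<close> and two mixed terms. Each mixed term contributes \<open>t\<close> times
  the product of the two means, so the mixed coefficient grows by \<open>2 * t\<close>, from
  \<open>t * (t - 1)\<close> to \<open>(t + 1) * t\<close>: it counts ordered pairs of distinct
  summands.\<close>

lemma nn_integral_convolution_power_biadditive:
  assumes [measurable]: "f \<in> borel_measurable borel" "g \<in> borel_measurable borel" "Measurable.pred borel P"
    and P: "AE x in N. P x" "P 0" "\<And>x y. P x \<Longrightarrow> P y \<Longrightarrow> P (x + y)"
    and f: "f 0 = 0" "\<And>x y. P x \<Longrightarrow> P y \<Longrightarrow> f (x + y) = f x + f y"
    and g: "g 0 = 0" "\<And>x y. P x \<Longrightarrow> P y \<Longrightarrow> g (x + y) = g x + g y"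
  shows "(\<integral>\<^sup>+x. f x * g x \<partial>convolution_power t N) =
    of_nat t * (\<integral>\<^sup>+x. f x * g x \<partial>N) + of_nat (t * (t - 1)) * (\<integral>\<^sup>+x. f x \<partial>N) * (\<integral>\<^sup>+x. g x \<partial>N)"
proof (induction t)
  case 0
  show ?case using f g by (simp add: nn_integral_return)
next
  case (Suc t)
  note [measurable_cong] = sets_convolution_power sets_N
  interpret N: prob_space N by (rule prob)
  interpret Q: prob_space "convolution_power t N" by (rule prob_space_convolution_power)
  have AE_t: "AE x in convolution_power t N. P x"
    by (rule AE_convolution_power) (fact | simp add: P)+
  have additive: "(\<integral>\<^sup>+x. h x \<partial>convolution_power t N) = of_nat t * (\<integral>\<^sup>+x. h x \<partial>N)"
    if "h \<in> borel_measurable borel" "h 0 = 0" "\<And>x y. P x \<Longrightarrow> P y \<Longrightarrow> h (x + y) = h x + h y" for h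
    by (rule nn_integral_convolution_power_additive[of h P]) (fact | simp add: P that)+
  have add_f: "integral\<^sup>N (convolution_power t N) f = of_nat t * integral\<^sup>N N f"
    and add_g: "integral\<^sup>N (convolution_power t N) g = of_nat t * integral\<^sup>N N g"
    by (rule additive; simp add: f g)+
  have "(\<integral>\<^sup>+x. f x * g x \<partial>convolution_power (Suc t) N) =
      (\<integral>\<^sup>+x. \<integral>\<^sup>+y. f (x + y) * g (x + y) \<partial>N \<partial>convolution_power t N)"
    by (intro nn_integral_convolution_power_Suc) simp
  also have "\<dots> = (\<integral>\<^sup>+x. \<integral>\<^sup>+y. f x * g x + f x * g y + f y * g x + f y * g y \<partial>N \<partial>convolution_power t N)"
  proof (rule nn_integral_cong_AE)
    show "AE x in convolution_power t N. (\<integral>\<^sup>+y. f (x + y) * g (x + y) \<partial>N) =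
        (\<integral>\<^sup>+y. f x * g x + f x * g y + f y * g x + f y * g y \<partial>N)"
      using AE_t
      by eventually_elim
        (use P(1) in \<open>auto intro!: nn_integral_cong_AE simp: f g distrib_left distrib_right add_ac\<close>)
  qed
  also have "\<dots> = (\<integral>\<^sup>+x. f x * g x \<partial>convolution_power t N)
      + (\<integral>\<^sup>+x. f x \<partial>convolution_power t N) * (\<integral>\<^sup>+x. g x \<partial>N)
      + (\<integral>\<^sup>+x. f x \<partial>N) * (\<integral>\<^sup>+x. g x \<partial>convolution_power t N) + (\<integral>\<^sup>+x. f x * g x \<partial>N)"
    by (simp add: nn_integral_add nn_integral_cmult nn_integral_multc N.emeasure_space_1 Q.emeasure_space_1)
  also have "\<dots> = of_nat t * (\<integral>\<^sup>+x. f x * g x \<partial>N) + (\<integral>\<^sup>+x. f x * g x \<partial>N) +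
      (of_nat (t * (t - 1)) + of_nat t + of_nat t) * (\<integral>\<^sup>+x. f x \<partial>N) * (\<integral>\<^sup>+x. g x \<partial>N)"
    unfolding Suc add_f add_g
    by (simp add: algebra_simps)
  \<comment> \<open>Natural subtraction is truncated, so \<open>t = 0\<close> is a case of its own;
    the factor \<open>t\<close> makes the coefficient 0 there.\<close>
  also have "of_nat (t * (t - 1)) + of_nat t + of_nat t = (of_nat (Suc t * (Suc t - 1)) :: ennreal)"
    unfolding of_nat_add[symmetric] by (rule arg_cong[where f = of_nat]) (cases t; simp)
  finally show ?case by (simp add: distrib_right add.commute)
qed

end

section \<open>Multinomial expansion\<close>

text \<open>A product of binomial coefficients stays in the naturals and matches the threefold use
  of the binomial theorem; \<open>multinomial_fact\<close> recovers the factorial quotient found in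
  the law of the counts.\<close>

definition multinomial :: "nat \<Rightarrow> nat \<Rightarrow> nat \<Rightarrow> nat \<Rightarrow> nat" where
  "multinomial t i j k = (t choose i) * ((t - i) choose j) * ((t - i - j) choose k)"

lemma multinomial_fact:
  assumes "i + j + k \<le> t"
  shows "real (multinomial t i j k) = fact t / (fact i * fact j * fact k * fact (t - i - j - k))"
  using assms by (simp add: multinomial_def binomial_fact field_simps)

text \<open>Three nested binomial expansions, peeling off \<open>a\<close>, \<open>b\<close> and
  \<open>c\<close> in turn. The general semiring matters: the sum over the counts is evaluated in
  \<open>ennreal\<close>.\<close>

lemma multinomial_theorem:
  fixes a b c d :: "'a::comm_semiring_1"
  shows "(a + b + c + d) ^ t = (\<Sum>(i, j, k)\<in>{(i, j, k). i + j + k \<le> t}.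
    of_nat (multinomial t i j k) * a ^ i * b ^ j * c ^ k * d ^ (t - i - j - k))"
proof -
  have "(a + b + c + d) ^ t = (a + (b + (c + d))) ^ t"
    by (simp add: add.assoc)
  also have "\<dots> = (\<Sum>i\<le>t. \<Sum>j\<le>t - i. \<Sum>k\<le>t - i - j.
      of_nat (multinomial t i j k) * a ^ i * b ^ j * c ^ k * d ^ (t - i - j - k))"
    by (simp add: binomial_ring multinomial_def sum_distrib_left mult_ac)
  also have "\<dots> = (\<Sum>(i, j, k)\<in>(SIGMA i:{..t}. SIGMA j:{..t - i}. {..t - i - j}).
      of_nat (multinomial t i j k) * a ^ i * b ^ j * c ^ k * d ^ (t - i - j - k))"
    by (simp add: sum.Sigma case_prod_unfold)
  also have "(SIGMA i:{..t}. SIGMA j:{..t - i}. {..t - i - j}) = {(i, j, k). i + j + k \<le> t}"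
    by auto
  finally show ?thesis .
qed

section \<open>Functionals of independent sequences\<close>

context prob_space
begin

lemma measurable_sequence:
  assumes "\<And>n. X n \<in> M \<rightarrow>\<^sub>M count_space UNIV"
  shows "(\<lambda>\<omega> n. X n \<omega>) \<in> M \<rightarrow>\<^sub>M PiM UNIV (\<lambda>_. count_space UNIV)"
  using assms by (intro measurable_PiM_single') auto

text \<open>The bridge from independence of whole sequences, stated for generated \<sigma>-algebras,
  to independence of numerical functionals \<open>g\<close> of them.\<close>

lemma vimage_in_generated_sigma:
  assumes "g \<in> PiM UNIV (\<lambda>_. count_space UNIV) \<rightarrow>\<^sub>M borel" and "A \<in> sets borel"
  shows "(\<lambda>\<omega>. g (\<lambda>n. X n \<omega>)) -` A \<inter> space M \<in> generated_sigma X"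
proof -
  have "(\<lambda>\<omega>. g (\<lambda>n. X n \<omega>)) -` A \<inter> space M =
      (\<lambda>\<omega> n. X n \<omega>) -` (g -` A \<inter> space (PiM UNIV (\<lambda>_. count_space UNIV))) \<inter> space M"
    by (auto simp: space_PiM)
  also have "\<dots> \<in> generated_sigma X"
    unfolding generated_sigma_def using assms
    by (intro in_vimage_algebra measurable_sets)
  finally show ?thesis .
qed

text \<open>With the discrete \<sigma>-algebra every \<open>h\<close> is measurable, so no condition
  on it is imposed. The product starts at 1 because the i.i.d. family does; for claim sizes the
  entry at index 0 is the constant 0.\<close>

lemma iid_from_1_nn_integral_prod:
  fixes h :: "'b \<Rightarrow> ennreal"
  assumes "iid_from_1 X"
  shows "(\<integral>\<^sup>+\<omega>. (\<Prod>i=1..n. h (X i \<omega>)) \<partial>M) = (\<integral>\<^sup>+\<omega>. h (X 1 \<omega>) \<partial>M) ^ n"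
proof -
  have "indep_vars (\<lambda>_. count_space UNIV) X {1..}"
    using assms unfolding iid_from_1_def by blast
  then have ind: "indep_vars (\<lambda>_. count_space UNIV) X {1..n}"
    by (rule indep_vars_subset) simp
  have dist: "\<And>i. i \<ge> 1 \<Longrightarrow> distr M (count_space UNIV) (X i) = distr M (count_space UNIV) (X 1)"
    using assms unfolding iid_from_1_def by blast
  have meas: "X i \<in> M \<rightarrow>\<^sub>M count_space UNIV" if "i \<ge> 1" for i
    using assms that unfolding iid_from_1_def indep_vars_def by auto
  have same: "(\<integral>\<^sup>+\<omega>. h (X i \<omega>) \<partial>M) = (\<integral>\<^sup>+\<omega>. h (X 1 \<omega>) \<partial>M)" if "i \<ge> 1" for i
    using dist[OF that] meas[OF that] meas[of 1]
      nn_integral_distr[of "X i" M "count_space UNIV" h] nn_integral_distr[of "X 1" M "count_space UNIV" h]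
    by simp
  have "(\<integral>\<^sup>+\<omega>. (\<Prod>i=1..n. h (X i \<omega>)) \<partial>M) = (\<Prod>i=1..n. \<integral>\<^sup>+\<omega>. h (X i \<omega>) \<partial>M)"
    using ind by (intro indep_vars_nn_integral indep_vars_compose2[OF ind]) auto
  also have "\<dots> = (\<integral>\<^sup>+\<omega>. h (X 1 \<omega>) \<partial>M) ^ n"
    by (subst prod.cong[OF refl same]) simp_all
  finally show ?thesis .
qed

end

section \<open>The compound multinomial model, conditioned on its counts\<close>

locale compound_multinomial = prob_space M for M :: "'a measure" +
  fixes p0 p1 p2 :: real
    and B0 B1 B2 :: "nat \<Rightarrow> 'a \<Rightarrow> nat"
    and Y :: "nat \<Rightarrow> nat \<Rightarrow> 'a \<Rightarrow> int"
  assumes p_nonneg: "p0 \<ge> 0" "p1 \<ge> 0" "p2 \<ge> 0" and p_le_1: "p0 + p1 + p2 \<le> 1"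
    and multinomial_process: "multinomial_process p0 p1 p2 B0 B1 B2"
    and claim_sizes: "claim_sizes Y"
    and claims_independent: "claims_independent B0 B1 B2 Y"
begin

definition counts :: "nat \<Rightarrow> 'a \<Rightarrow> nat \<times> nat \<times> nat" where
  "counts t \<omega> = (B0 t \<omega>, B1 t \<omega>, B2 t \<omega>)"

text \<open>Claim totals for fixed counts, which separates the two sources of randomness:
  \<open>S\<close> inserts the random counts. The first entry of the triple counts the common
  claims, those that hit both coordinates.\<close>

definition claim_sums :: "nat \<times> nat \<times> nat \<Rightarrow> 'a \<Rightarrow> real \<times> real" where
  "claim_sums = (\<lambda>(i, j, k) \<omega>.
     ((\<Sum>n=0..j. real_of_int (Y 1 n \<omega>)) + (\<Sum>n=0..i. real_of_int (Y 3 n \<omega>)),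
      (\<Sum>n=0..k. real_of_int (Y 2 n \<omega>)) + (\<Sum>n=0..i. real_of_int (Y 4 n \<omega>))))"

definition S :: "nat \<Rightarrow> 'a \<Rightarrow> real \<times> real" where
  "S t \<omega> = claim_sums (counts t \<omega>) \<omega>"

definition pmass :: "nat \<Rightarrow> nat \<times> nat \<times> nat \<Rightarrow> real" where
  "pmass t = (\<lambda>(i, j, k). real (multinomial t i j k) * p0 ^ i * p1 ^ j * p2 ^ k *
     (1 - (p0 + p1 + p2)) ^ (t - i - j - k))"

abbreviation support :: "nat \<Rightarrow> (nat \<times> nat \<times> nat) set" where
  "support t \<equiv> {(i, j, k). i + j + k \<le> t}"

lemma finite_support: "finite (support t)"
  by (rule finite_subset[of _ "{..t} \<times> {..t} \<times> {..t}"]) auto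

lemma measurable_Y [measurable]:
  "Y 1 i \<in> M \<rightarrow>\<^sub>M count_space UNIV" "Y 2 i \<in> M \<rightarrow>\<^sub>M count_space UNIV"
  "Y 3 i \<in> M \<rightarrow>\<^sub>M count_space UNIV" "Y 4 i \<in> M \<rightarrow>\<^sub>M count_space UNIV"
  using claim_sizes unfolding claim_sizes_def by auto

text \<open>The terms at index 0 vanish, which leaves exactly the indices covered by
  \<open>iid_from_1\<close>.\<close>

lemma claim_sums_eq:
  assumes "\<omega> \<in> space M"
  shows "claim_sums (i, j, k) \<omega> =
     ((\<Sum>n=1..j. real_of_int (Y 1 n \<omega>)) + (\<Sum>n=1..i. real_of_int (Y 3 n \<omega>)),
      (\<Sum>n=1..k. real_of_int (Y 2 n \<omega>)) + (\<Sum>n=1..i. real_of_int (Y 4 n \<omega>)))"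
proof -
  have "Y l 0 \<omega> = 0" if "l \<in> {1..4}" for l
    using claim_sizes assms that unfolding claim_sizes_def by blast
  then show ?thesis by (simp add: claim_sums_def sum.atLeast_Suc_atMost)
qed

lemma measurable_counts [measurable]: "counts t \<in> M \<rightarrow>\<^sub>M count_space UNIV"
proof -
  have [measurable]: "B0 t \<in> M \<rightarrow>\<^sub>M count_space UNIV" "B1 t \<in> M \<rightarrow>\<^sub>M count_space UNIV"
      "B2 t \<in> M \<rightarrow>\<^sub>M count_space UNIV"
    using multinomial_process unfolding multinomial_process_def by auto
  show ?thesis unfolding counts_def by measurable
qed

lemma measurable_claim_sums [measurable]: "claim_sums b \<in> borel_measurable M"
  unfolding claim_sums_def case_prod_unfold borel_prod[symmetric] by measurable

lemma measurable_S [measurable]: "S t \<in> borel_measurable M"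
  unfolding S_def by measurable

lemma AE_claim_pos: "AE \<omega> in M. \<forall>i\<ge>1. Y 1 i \<omega> > 0 \<and> Y 2 i \<omega> > 0 \<and> Y 3 i \<omega> > 0 \<and> Y 4 i \<omega> > 0"
proof -
  have pos: "AE \<omega> in M. Y k i \<omega> > 0" if "k \<in> {1..4}" "i \<ge> 1" for k i
  proof -
    have [measurable]: "Y k i \<in> M \<rightarrow>\<^sub>M count_space UNIV"
      using claim_sizes that(1) unfolding claim_sizes_def by auto
    have "prob {\<omega> \<in> space M. Y k i \<omega> > 0} = 1"
      using claim_sizes that unfolding claim_sizes_def by blast
    then show ?thesis by (subst (asm) prob_Collect_eq_1) measurable
  qed
  have "AE \<omega> in M. i \<ge> 1 \<longrightarrow> Y 1 i \<omega> > 0 \<and> Y 2 i \<omega> > 0 \<and> Y 3 i \<omega> > 0 \<and> Y 4 i \<omega> > 0" for i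
    using pos[of 1 i] pos[of 2 i] pos[of 3 i] pos[of 4 i] by (cases "i \<ge> 1") auto
  then show ?thesis by (simp add: AE_all_countable)
qed

lemma AE_S_nonneg: "AE \<omega> in M. 0 \<le> fst (S t \<omega>) \<and> 0 \<le> snd (S t \<omega>)"
  using AE_claim_pos AE_space
proof eventually_elim
  case (elim \<omega>)
  obtain i j k where counts: "counts t \<omega> = (i, j, k)"
    by (cases "counts t \<omega>")
  have "0 \<le> Y 1 n \<omega>" "0 \<le> Y 2 n \<omega>" "0 \<le> Y 3 n \<omega>" "0 \<le> Y 4 n \<omega>" if "n \<ge> 1" for n
    using elim(1) that by (auto intro: less_imp_le)
  then show ?case
    by (auto simp: S_def counts claim_sums_eq[OF elim(2)] intro!: add_nonneg_nonneg sum_nonneg)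
qed

lemma prob_counts:
  "prob {\<omega> \<in> space M. counts t \<omega> = b} = (if b \<in> support t then pmass t b else 0)"
proof -
  obtain i j k where b: "b = (i, j, k)" by (cases b)
  show ?thesis
    using multinomial_process unfolding multinomial_process_def b counts_def
    by (auto simp: pmass_def multinomial_fact)
qed

text \<open>Each triple outside the simplex has probability 0, and there are only countably many
  triples.\<close>

lemma AE_counts_support: "AE \<omega> in M. counts t \<omega> \<in> support t"
proof -
  have "AE \<omega> in M. \<forall>b. b \<notin> support t \<longrightarrow> counts t \<omega> \<noteq> b"
  proof (subst AE_all_countable, intro allI)
    fix b
    show "AE \<omega> in M. b \<notin> support t \<longrightarrow> counts t \<omega> \<noteq> b"
    proof (cases "b \<in> support t")
      case False
      then have "prob {\<omega> \<in> space M. counts t \<omega> = b} = 0"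
        by (simp only: prob_counts if_False)
      then have "AE \<omega> in M. \<not> counts t \<omega> = b"
        by (subst (asm) prob_Collect_eq_0) measurable
      then show ?thesis by auto
    qed auto
  qed
  then show ?thesis by eventually_elim auto
qed

lemma pmass_nonneg: "pmass t b \<ge> 0"
  using p_nonneg p_le_1 by (auto simp: pmass_def case_prod_unfold)

text \<open>The four functionals are gathered in a list so that they follow the indexing of
  \<open>claims_independent\<close>. Their preimages lie in the four generated \<sigma>-algebras,
  and independence passes to smaller families of sets.\<close>

lemma nn_integral_prod_independent:
  fixes g0 :: "(nat \<Rightarrow> nat \<times> nat \<times> nat) \<Rightarrow> ennreal" and g1 g2 :: "(nat \<Rightarrow> int) \<Rightarrow> ennreal"
    and g3 :: "(nat \<Rightarrow> int \<times> int) \<Rightarrow> ennreal"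
  assumes g: "g0 \<in> PiM UNIV (\<lambda>_. count_space UNIV) \<rightarrow>\<^sub>M borel"
    "g1 \<in> PiM UNIV (\<lambda>_. count_space UNIV) \<rightarrow>\<^sub>M borel"
    "g2 \<in> PiM UNIV (\<lambda>_. count_space UNIV) \<rightarrow>\<^sub>M borel"
    "g3 \<in> PiM UNIV (\<lambda>_. count_space UNIV) \<rightarrow>\<^sub>M borel"
  shows "(\<integral>\<^sup>+\<omega>. g0 (\<lambda>t. counts t \<omega>) * g1 (\<lambda>i. Y 1 i \<omega>) * g2 (\<lambda>i. Y 2 i \<omega>) *
            g3 (\<lambda>i. (Y 3 i \<omega>, Y 4 i \<omega>)) \<partial>M) =
    (\<integral>\<^sup>+\<omega>. g0 (\<lambda>t. counts t \<omega>) \<partial>M) * (\<integral>\<^sup>+\<omega>. g1 (\<lambda>i. Y 1 i \<omega>) \<partial>M) *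
    (\<integral>\<^sup>+\<omega>. g2 (\<lambda>i. Y 2 i \<omega>) \<partial>M) * (\<integral>\<^sup>+\<omega>. g3 (\<lambda>i. (Y 3 i \<omega>, Y 4 i \<omega>)) \<partial>M)"
proof -
  define V :: "nat \<Rightarrow> 'a \<Rightarrow> ennreal" where
    "V = (\<lambda>l. [\<lambda>\<omega>. g0 (\<lambda>t. counts t \<omega>), \<lambda>\<omega>. g1 (\<lambda>i. Y 1 i \<omega>), \<lambda>\<omega>. g2 (\<lambda>i. Y 2 i \<omega>),
               \<lambda>\<omega>. g3 (\<lambda>i. (Y 3 i \<omega>, Y 4 i \<omega>))] ! l)"
  have split: "P 0 \<Longrightarrow> P 1 \<Longrightarrow> P 2 \<Longrightarrow> P 3 \<Longrightarrow> l < 4 \<Longrightarrow> P l" for P and l :: nat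
    by (auto simp: numeral_eq_Suc less_Suc_eq)
  note seq = measurable_sequence[of counts, OF measurable_counts]
    measurable_sequence[of "Y 1", OF measurable_Y(1)] measurable_sequence[of "Y 2", OF measurable_Y(2)]
  have "(\<lambda>\<omega>. (Y 3 i \<omega>, Y 4 i \<omega>)) \<in> M \<rightarrow>\<^sub>M count_space UNIV" for i
    by measurable
  note seq = seq measurable_sequence[of "\<lambda>i \<omega>. (Y 3 i \<omega>, Y 4 i \<omega>)", OF this]
  have meas: "V l \<in> borel_measurable M" if "l < 4" for l
    using that
    by (rule split[rotated -1])
      (simp_all add: V_def del: One_nat_def add: measurable_compose[OF seq(1) g(1)] measurable_compose[OF seq(2) g(2)]
        measurable_compose[OF seq(3) g(3)] measurable_compose[OF seq(4) g(4)])
  have "indep_sets (\<lambda>l. {V l -` A \<inter> space M |A. A \<in> sets borel}) {..<4}"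
  proof (rule indep_sets_mono_sets[OF claims_independent[unfolded claims_independent_def]])
    fix l :: nat assume "l \<in> {..<4}"
    then have "l < 4" by simp
    then show "{V l -` A \<inter> space M |A. A \<in> sets borel} \<subseteq>
      [generated_sigma (\<lambda>t \<omega>. (B0 t \<omega>, B1 t \<omega>, B2 t \<omega>)), generated_sigma (Y 1),
       generated_sigma (Y 2), generated_sigma (\<lambda>i \<omega>. (Y 3 i \<omega>, Y 4 i \<omega>))] ! l"
      using vimage_in_generated_sigma[OF g(1)] vimage_in_generated_sigma[OF g(2)]
        vimage_in_generated_sigma[OF g(3)] vimage_in_generated_sigma[OF g(4)]
      by (rule_tac split[rotated -1]) (auto simp: V_def counts_def)
  qed
  then have "indep_vars (\<lambda>_. borel) V {..<4}"
    using meas by (auto simp: indep_vars_def2)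
  then have "(\<integral>\<^sup>+\<omega>. (\<Prod>l<4. V l \<omega>) \<partial>M) = (\<Prod>l<4. \<integral>\<^sup>+\<omega>. V l \<omega> \<partial>M)"
    by (intro indep_vars_nn_integral) auto
  then show ?thesis
    by (simp add: V_def numeral_eq_Suc mult.assoc)
qed

text \<open>Conditioning on \<open>counts t\<close>, written as a finite sum over its values. On the
  event \<open>counts t \<omega> = b\<close> the integrand is \<open>H b\<close>, with the counts
  frozen; since that splits into one factor for each claim sequence, independence turns its
  expectation into a product.\<close>

lemma nn_integral_counts:
  assumes [measurable]: "\<And>b. H b \<in> borel_measurable M"
    and "\<And>b. b \<in> support t \<Longrightarrow> g1 b \<in> PiM UNIV (\<lambda>_. count_space UNIV) \<rightarrow>\<^sub>M borel"
    and "\<And>b. b \<in> support t \<Longrightarrow> g2 b \<in> PiM UNIV (\<lambda>_. count_space UNIV) \<rightarrow>\<^sub>M borel"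
    and "\<And>b. b \<in> support t \<Longrightarrow> g3 b \<in> PiM UNIV (\<lambda>_. count_space UNIV) \<rightarrow>\<^sub>M borel"
    and H: "\<And>b \<omega>. b \<in> support t \<Longrightarrow> \<omega> \<in> space M \<Longrightarrow>
      H b \<omega> = g1 b (\<lambda>i. Y 1 i \<omega>) * g2 b (\<lambda>i. Y 2 i \<omega>) * g3 b (\<lambda>i. (Y 3 i \<omega>, Y 4 i \<omega>))"
  shows "(\<integral>\<^sup>+\<omega>. H (counts t \<omega>) \<omega> \<partial>M) =
    (\<Sum>b\<in>support t. ennreal (pmass t b) * (\<integral>\<^sup>+\<omega>. g1 b (\<lambda>i. Y 1 i \<omega>) \<partial>M) *
      (\<integral>\<^sup>+\<omega>. g2 b (\<lambda>i. Y 2 i \<omega>) \<partial>M) * (\<integral>\<^sup>+\<omega>. g3 b (\<lambda>i. (Y 3 i \<omega>, Y 4 i \<omega>)) \<partial>M))"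
proof -
  have ind_meas: "(\<lambda>\<omega>. indicator {b} (counts t \<omega>) :: ennreal) \<in> borel_measurable M" for b
    by (rule measurable_compose[OF measurable_counts]) simp
  have "(\<integral>\<^sup>+\<omega>. H (counts t \<omega>) \<omega> \<partial>M) =
      (\<integral>\<^sup>+\<omega>. (\<Sum>b\<in>support t. indicator {b} (counts t \<omega>) * H b \<omega>) \<partial>M)"
  proof (rule nn_integral_cong_AE)
    show "AE \<omega> in M. H (counts t \<omega>) \<omega> = (\<Sum>b\<in>support t. indicator {b} (counts t \<omega>) * H b \<omega>)"
      using AE_counts_support[of t]
    proof eventually_elim
      case (elim \<omega>)
      have "(\<Sum>b\<in>support t. indicator {b} (counts t \<omega>) * H b \<omega>) =
          (\<Sum>b\<in>support t. if b = counts t \<omega> then H b \<omega> else 0)"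
        by (rule sum.cong) (auto simp: indicator_def)
      also have "\<dots> = H (counts t \<omega>) \<omega>"
        using elim finite_support by (subst sum.delta) auto
      finally show ?case by simp
    qed
  qed
  also have "\<dots> = (\<Sum>b\<in>support t. \<integral>\<^sup>+\<omega>. indicator {b} (counts t \<omega>) * H b \<omega> \<partial>M)"
    by (intro nn_integral_sum borel_measurable_times_ennreal assms(1) ind_meas)
  also have "\<dots> = (\<Sum>b\<in>support t. ennreal (pmass t b) * (\<integral>\<^sup>+\<omega>. g1 b (\<lambda>i. Y 1 i \<omega>) \<partial>M) *
      (\<integral>\<^sup>+\<omega>. g2 b (\<lambda>i. Y 2 i \<omega>) \<partial>M) * (\<integral>\<^sup>+\<omega>. g3 b (\<lambda>i. (Y 3 i \<omega>, Y 4 i \<omega>)) \<partial>M))"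
  proof (rule sum.cong[OF refl])
    fix b assume b: "b \<in> support t"
    have ind: "(\<integral>\<^sup>+\<omega>. indicator {b} (counts t \<omega>) \<partial>M) = ennreal (pmass t b)"
    proof -
      have "(\<integral>\<^sup>+\<omega>. indicator {b} (counts t \<omega>) \<partial>M) =
          (\<integral>\<^sup>+\<omega>. indicator {\<omega> \<in> space M. counts t \<omega> = b} \<omega> \<partial>M)"
        by (intro nn_integral_cong) (auto simp: indicator_def)
      also have "\<dots> = ennreal (prob {\<omega> \<in> space M. counts t \<omega> = b})"
        by (subst nn_integral_indicator) (auto simp: emeasure_eq_measure)
      finally show ?thesis using b by (simp only: prob_counts if_True)
    qed
    have "(\<integral>\<^sup>+\<omega>. indicator {b} (counts t \<omega>) * H b \<omega> \<partial>M) =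
      (\<integral>\<^sup>+\<omega>. indicator {b} (counts t \<omega>) * g1 b (\<lambda>i. Y 1 i \<omega>) * g2 b (\<lambda>i. Y 2 i \<omega>) *
         g3 b (\<lambda>i. (Y 3 i \<omega>, Y 4 i \<omega>)) \<partial>M)"
      by (intro nn_integral_cong) (simp add: H[OF b] mult.assoc)
    also have "\<dots> = ennreal (pmass t b) * (\<integral>\<^sup>+\<omega>. g1 b (\<lambda>i. Y 1 i \<omega>) \<partial>M) *
      (\<integral>\<^sup>+\<omega>. g2 b (\<lambda>i. Y 2 i \<omega>) \<partial>M) * (\<integral>\<^sup>+\<omega>. g3 b (\<lambda>i. (Y 3 i \<omega>, Y 4 i \<omega>)) \<partial>M)"
      unfolding ind[symmetric]
    \<comment> \<open>The event that the counts at time \<open>t\<close> equal \<open>b\<close>,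
      read as a functional of the whole counting process by evaluation at coordinate
      \<open>t\<close>.\<close>
    proof (rule nn_integral_prod_independent[where ?g0.0 = "\<lambda>c. indicator {b} (c t)"])
      show "(\<lambda>c. indicator {b} (c t)) \<in> borel_measurable (PiM UNIV (\<lambda>_. count_space UNIV))"
        by (rule measurable_compose[OF measurable_component_singleton]) simp_all
    qed (fact assms(2-4)[OF b])+
    finally show "(\<integral>\<^sup>+\<omega>. indicator {b} (counts t \<omega>) * H b \<omega> \<partial>M) = \<dots>" .
  qed
  finally show ?thesis .
qed

text \<open>The exponential turns claim totals into products over claims, so fixed counts give
  powers of the three one-claim transforms with the counts as exponents. No sign is imposed on
  \<open>a\<close> and \<open>b\<close>: the values may be infinite, and the identity
  persists.\<close>

lemma nn_integral_exp_S:
  "(\<integral>\<^sup>+\<omega>. ennreal (exp (- a * fst (S t \<omega>) - b * snd (S t \<omega>))) \<partial>M) =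
    (ennreal (1 - (p0 + p1 + p2))
     + ennreal p1 * (\<integral>\<^sup>+\<omega>. ennreal (exp (- a * real_of_int (Y 1 1 \<omega>))) \<partial>M)
     + ennreal p0 * (\<integral>\<^sup>+\<omega>. ennreal (exp (- (a * real_of_int (Y 3 1 \<omega>) + b * real_of_int (Y 4 1 \<omega>)))) \<partial>M)
     + ennreal p2 * (\<integral>\<^sup>+\<omega>. ennreal (exp (- b * real_of_int (Y 2 1 \<omega>))) \<partial>M)) ^ t"
proof -
  define e1 e2 :: "int \<Rightarrow> ennreal" and e3 :: "int \<times> int \<Rightarrow> ennreal"
    where "e1 y = ennreal (exp (- a * real_of_int y))"
    and "e2 y = ennreal (exp (- b * real_of_int y))"
    and "e3 z = ennreal (exp (- (a * real_of_int (fst z) + b * real_of_int (snd z))))" for y z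
  have "iid_from_1 (Y 1)" "iid_from_1 (Y 2)" "iid_from_1 (\<lambda>n \<omega>. (Y 3 n \<omega>, Y 4 n \<omega>))"
    using claim_sizes unfolding claim_sizes_def by blast+
  note iid = this[THEN iid_from_1_nn_integral_prod]
  have "(\<integral>\<^sup>+\<omega>. ennreal (exp (- a * fst (S t \<omega>) - b * snd (S t \<omega>))) \<partial>M) =
    (\<Sum>c\<in>support t. ennreal (pmass t c) * (\<integral>\<^sup>+\<omega>. (\<Prod>n=1..fst (snd c). e1 (Y 1 n \<omega>)) \<partial>M) *
      (\<integral>\<^sup>+\<omega>. (\<Prod>n=1..snd (snd c). e2 (Y 2 n \<omega>)) \<partial>M) * (\<integral>\<^sup>+\<omega>. (\<Prod>n=1..fst c. e3 (Y 3 n \<omega>, Y 4 n \<omega>)) \<partial>M))"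
    unfolding S_def
  proof (rule nn_integral_counts[where H = "\<lambda>c \<omega>. ennreal (exp (- a * fst (claim_sums c \<omega>) - b * snd (claim_sums c \<omega>)))"
        and ?g1.0 = "\<lambda>c y. \<Prod>n=1..fst (snd c). e1 (y n)"
        and ?g2.0 = "\<lambda>c y. \<Prod>n=1..snd (snd c). e2 (y n)"
        and ?g3.0 = "\<lambda>c y. \<Prod>n=1..fst c. e3 (y n)"])
    show "(\<lambda>\<omega>. ennreal (exp (- a * fst (claim_sums c \<omega>) - b * snd (claim_sums c \<omega>)))) \<in> borel_measurable M" for c
      by (rule measurable_compose[OF measurable_claim_sums])
        (unfold borel_prod[symmetric], measurable)
    fix c :: "nat \<times> nat \<times> nat" and \<omega> assume \<omega>: "\<omega> \<in> space M"
    obtain i j k where c: "c = (i, j, k)" by (cases c)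
    show "ennreal (exp (- a * fst (claim_sums c \<omega>) - b * snd (claim_sums c \<omega>))) =
      (\<Prod>n=1..fst (snd c). e1 (Y 1 n \<omega>)) * (\<Prod>n=1..snd (snd c). e2 (Y 2 n \<omega>)) *
      (\<Prod>n=1..fst c. e3 (Y 3 n \<omega>, Y 4 n \<omega>))"
      unfolding e1_def e2_def e3_def
      by (simp add: c claim_sums_eq[OF \<omega>] prod_ennreal ennreal_mult[symmetric] prod_nonneg
        exp_sum[symmetric] exp_add[symmetric] sum_distrib_left sum.distrib sum_negf sum_subtractf algebra_simps)
  qed measurable
  also have "\<dots> = (\<Sum>c\<in>support t. ennreal (pmass t c) * (\<integral>\<^sup>+\<omega>. e1 (Y 1 1 \<omega>) \<partial>M) ^ fst (snd c) *
      (\<integral>\<^sup>+\<omega>. e2 (Y 2 1 \<omega>) \<partial>M) ^ snd (snd c) * (\<integral>\<^sup>+\<omega>. e3 (Y 3 1 \<omega>, Y 4 1 \<omega>) \<partial>M) ^ fst c)"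
    by (simp only: iid)
  \<comment> \<open>The summands stand in the order of the triple of counts, common claims first, to
    fit \<open>multinomial_theorem\<close>.\<close>
  also have "\<dots> = (ennreal p0 * (\<integral>\<^sup>+\<omega>. e3 (Y 3 1 \<omega>, Y 4 1 \<omega>) \<partial>M) + ennreal p1 * (\<integral>\<^sup>+\<omega>. e1 (Y 1 1 \<omega>) \<partial>M)
      + ennreal p2 * (\<integral>\<^sup>+\<omega>. e2 (Y 2 1 \<omega>) \<partial>M) + ennreal (1 - (p0 + p1 + p2))) ^ t"
    unfolding multinomial_theorem
  proof (intro sum.cong refl, clarify)
    fix i j k :: nat
    have "ennreal (pmass t (i, j, k)) = of_nat (multinomial t i j k) * ennreal p0 ^ i * ennreal p1 ^ j *
        ennreal p2 ^ k * ennreal (1 - (p0 + p1 + p2)) ^ (t - i - j - k)"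
      using p_nonneg p_le_1
      by (simp add: pmass_def ennreal_mult ennreal_power ennreal_of_nat_eq_real_of_nat)
    then show "ennreal (pmass t (i, j, k)) * (\<integral>\<^sup>+\<omega>. e1 (Y 1 1 \<omega>) \<partial>M) ^ fst (snd (i, j, k)) *
      (\<integral>\<^sup>+\<omega>. e2 (Y 2 1 \<omega>) \<partial>M) ^ snd (snd (i, j, k)) * (\<integral>\<^sup>+\<omega>. e3 (Y 3 1 \<omega>, Y 4 1 \<omega>) \<partial>M) ^ fst (i, j, k) =
      of_nat (multinomial t i j k) * (ennreal p0 * (\<integral>\<^sup>+\<omega>. e3 (Y 3 1 \<omega>, Y 4 1 \<omega>) \<partial>M)) ^ i *
      (ennreal p1 * (\<integral>\<^sup>+\<omega>. e1 (Y 1 1 \<omega>) \<partial>M)) ^ j * (ennreal p2 * (\<integral>\<^sup>+\<omega>. e2 (Y 2 1 \<omega>) \<partial>M)) ^ k *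
      ennreal (1 - (p0 + p1 + p2)) ^ (t - i - j - k)"
      by (simp add: power_mult_distrib mult_ac)
  qed
  finally show ?thesis
    by (simp add: e1_def e2_def e3_def add_ac)
qed

lemma support_1: "support 1 = {(0, 0, 0), (1, 0, 0), (0, 1, 0), (0, 0, 1)}"
  by auto

text \<open>At time 1 at most one of the three counts is nonzero, and it is then 1. The condition
  \<open>h (0, 0) = 0\<close>, satisfied by coordinates and their products, removes the triple
  without claims and its weight \<open>1 - (p0 + p1 + p2)\<close>.\<close>

lemma nn_integral_S_1:
  assumes [measurable]: "h \<in> borel_measurable borel" and "h (0, 0) = 0"
  shows "(\<integral>\<^sup>+\<omega>. h (S 1 \<omega>) \<partial>M) =
    ennreal p1 * (\<integral>\<^sup>+\<omega>. h (real_of_int (Y 1 1 \<omega>), 0) \<partial>M) +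
    ennreal p0 * (\<integral>\<^sup>+\<omega>. h (real_of_int (Y 3 1 \<omega>), real_of_int (Y 4 1 \<omega>)) \<partial>M) +
    ennreal p2 * (\<integral>\<^sup>+\<omega>. h (0, real_of_int (Y 2 1 \<omega>)) \<partial>M)"
proof -
  \<comment> \<open>Each value of \<open>h\<close> is placed in the factor of the one sequence that
    it depends on, the other factors being 1; for the triple \<open>(0, 0, 0)\<close> the value 0 is
    placed in \<open>g1\<close>.\<close>
  define g1 g2 :: "nat \<times> nat \<times> nat \<Rightarrow> (nat \<Rightarrow> int) \<Rightarrow> ennreal"
    and g3 :: "nat \<times> nat \<times> nat \<Rightarrow> (nat \<Rightarrow> int \<times> int) \<Rightarrow> ennreal"
    where "g1 c y = (if c = (0, 1, 0) then h (real_of_int (y 1), 0) else if c = (0, 0, 0) then 0 else 1)"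
    and "g2 c y = (if c = (0, 0, 1) then h (0, real_of_int (y 1)) else 1)"
    and "g3 c z = (if c = (1, 0, 0) then h (real_of_int (fst (z 1)), real_of_int (snd (z 1))) else 1)" for c y z
  have "(\<integral>\<^sup>+\<omega>. h (S 1 \<omega>) \<partial>M) = (\<Sum>c\<in>support 1. ennreal (pmass 1 c) * (\<integral>\<^sup>+\<omega>. g1 c (\<lambda>n. Y 1 n \<omega>) \<partial>M) *
      (\<integral>\<^sup>+\<omega>. g2 c (\<lambda>n. Y 2 n \<omega>) \<partial>M) * (\<integral>\<^sup>+\<omega>. g3 c (\<lambda>n. (Y 3 n \<omega>, Y 4 n \<omega>)) \<partial>M))"
    unfolding S_def
  proof (rule nn_integral_counts)
    fix c :: "nat \<times> nat \<times> nat" and \<omega> assume "c \<in> support 1" and \<omega>: "\<omega> \<in> space M"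
    then show "h (claim_sums c \<omega>) = g1 c (\<lambda>n. Y 1 n \<omega>) * g2 c (\<lambda>n. Y 2 n \<omega>) * g3 c (\<lambda>n. (Y 3 n \<omega>, Y 4 n \<omega>))"
      unfolding support_1 using assms(2)
      by (auto simp: g1_def g2_def g3_def claim_sums_eq[OF \<omega>])
  qed (unfold g1_def g2_def g3_def, measurable)
  also have "\<dots> = ennreal p1 * (\<integral>\<^sup>+\<omega>. h (real_of_int (Y 1 1 \<omega>), 0) \<partial>M) +
    ennreal p0 * (\<integral>\<^sup>+\<omega>. h (real_of_int (Y 3 1 \<omega>), real_of_int (Y 4 1 \<omega>)) \<partial>M) +
    ennreal p2 * (\<integral>\<^sup>+\<omega>. h (0, real_of_int (Y 2 1 \<omega>)) \<partial>M)"
    unfolding support_1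
    by (simp add: g1_def g2_def g3_def pmass_def multinomial_def emeasure_space_1 add_ac)
  finally show ?thesis .
qed

end

section \<open>The law of the claim totals\<close>

lemma borel_measurable_fst_snd [measurable]:
  "(fst :: 'a::second_countable_topology \<times> 'b::second_countable_topology \<Rightarrow> 'a) \<in> borel_measurable borel"
  "(snd :: 'a \<times> 'b \<Rightarrow> 'b) \<in> borel_measurable borel"
  by (intro borel_measurable_continuous_onI continuous_intros)+

context compound_multinomial
begin

abbreviation mean :: "nat \<Rightarrow> real" where
  "mean k \<equiv> expectation (\<lambda>\<omega>. real_of_int (Y k 1 \<omega>))"

abbreviation second_moment :: "nat \<Rightarrow> real" where
  "second_moment k \<equiv> expectation (\<lambda>\<omega>. (real_of_int (Y k 1 \<omega>))\<^sup>2)"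

abbreviation cross_moment :: real where
  "cross_moment \<equiv> expectation (\<lambda>\<omega>. real_of_int (Y 3 1 \<omega>) * real_of_int (Y 4 1 \<omega>))"

lemma AE_first_claims_nonneg:
  "AE \<omega> in M. 0 \<le> real_of_int (Y 1 1 \<omega>) \<and> 0 \<le> real_of_int (Y 2 1 \<omega>) \<and>
     0 \<le> real_of_int (Y 3 1 \<omega>) \<and> 0 \<le> real_of_int (Y 4 1 \<omega>)"
  using AE_claim_pos by eventually_elim (auto intro: less_imp_le)

lemma measurable_first_claim:
  assumes "k \<in> {1..4}" shows "(\<lambda>\<omega>. real_of_int (Y k 1 \<omega>)) \<in> borel_measurable M"
proof -
  have "Y k 1 \<in> M \<rightarrow>\<^sub>M count_space UNIV"
    using claim_sizes assms unfolding claim_sizes_def by blast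
  then show ?thesis by (rule measurable_compose) simp
qed

lemma AE_first_claim_nonneg: "k \<in> {1..4} \<Longrightarrow> AE \<omega> in M. 0 \<le> real_of_int (Y k 1 \<omega>)"
proof -
  assume "k \<in> {1..4}"
  then have "k = 1 \<or> k = 2 \<or> k = 3 \<or> k = 4" by auto
  then show ?thesis using AE_first_claims_nonneg by auto
qed

text \<open>For nonnegative \<open>a\<close> and \<open>b\<close> the one-claim exponentials are
  almost surely at most 1, so the identity in \<open>ennreal\<close> has finite values and descends
  to real expectations.\<close>

lemma expectation_exp_S:
  assumes "a \<ge> 0" "b \<ge> 0"
  shows "expectation (\<lambda>\<omega>. exp (- a * fst (S t \<omega>) - b * snd (S t \<omega>))) =
    (1 - (p0 + p1 + p2)
     + p1 * expectation (\<lambda>\<omega>. exp (- a * real_of_int (Y 1 1 \<omega>)))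
     + p0 * expectation (\<lambda>\<omega>. exp (- (a * real_of_int (Y 3 1 \<omega>) + b * real_of_int (Y 4 1 \<omega>))))
     + p2 * expectation (\<lambda>\<omega>. exp (- b * real_of_int (Y 2 1 \<omega>)))) ^ t"
proof -
  have fin: "(\<integral>\<^sup>+\<omega>. ennreal (exp (- f \<omega>)) \<partial>M) = ennreal (expectation (\<lambda>\<omega>. exp (- f \<omega>)))"
    if [measurable]: "f \<in> borel_measurable M" and "AE \<omega> in M. 0 \<le> f \<omega>" for f
    using that(2)
    by (intro nn_integral_eq_integral integrable_const_bound[where B = 1]) auto
  have e: "(\<integral>\<^sup>+\<omega>. ennreal (exp (- a * real_of_int (Y 1 1 \<omega>))) \<partial>M) =
      ennreal (expectation (\<lambda>\<omega>. exp (- a * real_of_int (Y 1 1 \<omega>))))"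
    "(\<integral>\<^sup>+\<omega>. ennreal (exp (- b * real_of_int (Y 2 1 \<omega>))) \<partial>M) =
      ennreal (expectation (\<lambda>\<omega>. exp (- b * real_of_int (Y 2 1 \<omega>))))"
    "(\<integral>\<^sup>+\<omega>. ennreal (exp (- (a * real_of_int (Y 3 1 \<omega>) + b * real_of_int (Y 4 1 \<omega>)))) \<partial>M) =
      ennreal (expectation (\<lambda>\<omega>. exp (- (a * real_of_int (Y 3 1 \<omega>) + b * real_of_int (Y 4 1 \<omega>)))))"
    unfolding minus_mult_left[symmetric]
  proof (rule_tac [!] fin)
    show "AE \<omega> in M. 0 \<le> a * real_of_int (Y 1 1 \<omega>)" "AE \<omega> in M. 0 \<le> b * real_of_int (Y 2 1 \<omega>)"
      "AE \<omega> in M. 0 \<le> a * real_of_int (Y 3 1 \<omega>) + b * real_of_int (Y 4 1 \<omega>)"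
      using AE_first_claims_nonneg by (eventually_elim, use assms in simp)+
  qed measurable
  have [measurable]: "(\<lambda>\<omega>. fst (S t \<omega>)) \<in> borel_measurable M" "(\<lambda>\<omega>. snd (S t \<omega>)) \<in> borel_measurable M"
    by measurable
  have "expectation (\<lambda>\<omega>. exp (- a * fst (S t \<omega>) - b * snd (S t \<omega>))) =
      enn2real (\<integral>\<^sup>+\<omega>. ennreal (exp (- a * fst (S t \<omega>) - b * snd (S t \<omega>))) \<partial>M)"
    by (rule integral_eq_nn_integral) auto
  also have "\<dots> = enn2real (ennreal ((1 - (p0 + p1 + p2)
     + p1 * expectation (\<lambda>\<omega>. exp (- a * real_of_int (Y 1 1 \<omega>)))
     + p0 * expectation (\<lambda>\<omega>. exp (- (a * real_of_int (Y 3 1 \<omega>) + b * real_of_int (Y 4 1 \<omega>))))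
     + p2 * expectation (\<lambda>\<omega>. exp (- b * real_of_int (Y 2 1 \<omega>)))) ^ t))"
    unfolding nn_integral_exp_S e using p_nonneg p_le_1
    by (simp add: ennreal_power ennreal_mult[symmetric] ennreal_plus[symmetric] integral_nonneg_AE
        add_nonneg_nonneg del: ennreal_plus)
  also have "\<dots> = (1 - (p0 + p1 + p2)
     + p1 * expectation (\<lambda>\<omega>. exp (- a * real_of_int (Y 1 1 \<omega>)))
     + p0 * expectation (\<lambda>\<omega>. exp (- (a * real_of_int (Y 3 1 \<omega>) + b * real_of_int (Y 4 1 \<omega>))))
     + p2 * expectation (\<lambda>\<omega>. exp (- b * real_of_int (Y 2 1 \<omega>)))) ^ t"
    using p_nonneg p_le_1
    by (intro enn2real_ennreal zero_le_power add_nonneg_nonneg mult_nonneg_nonneg integral_nonneg_AE) auto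
  finally show ?thesis .
qed

lemma prob_space_law: "prob_space (distr M borel (S t))"
  by (rule prob_space_distr) (rule measurable_S)

lemma AE_law_nonneg: "AE x in distr M borel (S t). 0 \<le> fst x \<and> 0 \<le> snd x"
  using AE_S_nonneg by (subst AE_distr_iff) simp_all

lemma law_unique:
  assumes L: "prob_space L" "sets L = sets borel" "AE x in L. fst x \<ge> 0 \<and> snd x \<ge> 0"
    and eq: "\<And>a b. a \<ge> 0 \<Longrightarrow> b \<ge> 0 \<Longrightarrow> (\<integral>x. exp (- a * fst x - b * snd x) \<partial>L) =
      expectation (\<lambda>\<omega>. exp (- a * fst (S t \<omega>) - b * snd (S t \<omega>)))"
  shows "L = distr M borel (S t)"
proof (rule Laplace_transform_unique)
  fix a b :: real assume "a \<ge> 0" "b \<ge> 0"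
  from eq[OF this]
  show "(\<integral>x. exp (- a * fst x - b * snd x) \<partial>L) = (\<integral>x. exp (- a * fst x - b * snd x) \<partial>distr M borel (S t))"
    by (simp add: integral_distr)
qed (use L AE_law_nonneg prob_space_law in auto)

text \<open>Both laws live on the quadrant, so comparing transforms at nonnegative arguments is
  enough. Moments at time \<open>t\<close> are thereby reduced to moments at time 1.\<close>

lemma law_S_convolution_power: "distr M borel (S t) = convolution_power t (distr M borel (S 1))"
proof (rule law_unique[symmetric])
  let ?N = "distr M borel (S 1)"
  interpret P: prob_space "convolution_power t ?N"
    by (rule prob_space_convolution_power) (simp_all add: prob_space_law)
  show "prob_space (convolution_power t ?N)" by (rule P.prob_space_axioms)
  show sets: "sets (convolution_power t ?N) = sets borel"
    by (rule sets_convolution_power) (simp_all add: prob_space_law)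
  note [measurable_cong] = sets
  show "AE x in convolution_power t ?N. fst x \<ge> 0 \<and> snd x \<ge> 0"
    using AE_law_nonneg[of 1] by (intro AE_convolution_power) (auto simp: prob_space_law)
  fix a b :: real assume ab: "a \<ge> 0" "b \<ge> 0"
  define h :: "real \<times> real \<Rightarrow> real" where "h x = exp (- a * fst x - b * snd x)" for x
  have h [measurable]: "h \<in> borel_measurable borel"
    unfolding h_def by (intro borel_measurable_continuous_onI continuous_intros)
  have meas: "h \<in> borel_measurable (convolution_power t ?N)"
    by measurable
  have hS: "(\<integral>\<^sup>+x. ennreal (h x) \<partial>distr M borel (S s)) =
      (\<integral>\<^sup>+\<omega>. ennreal (exp (- a * fst (S s \<omega>) - b * snd (S s \<omega>))) \<partial>M)" for s
    by (subst nn_integral_distr) (auto simp: h_def)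
  \<comment> \<open>For a nonnegative measurable function the Bochner integral is
    \<open>enn2real\<close> of the nonnegative integral, finite or not; the comparison can be made
    in \<open>ennreal\<close> without an integrability check.\<close>
  have "(\<integral>x. h x \<partial>convolution_power t ?N) = enn2real (\<integral>\<^sup>+x. ennreal (h x) \<partial>convolution_power t ?N)"
    using meas by (rule integral_eq_nn_integral) (simp add: h_def)
  also have "(\<integral>\<^sup>+x. ennreal (h x) \<partial>convolution_power t ?N) = (\<integral>\<^sup>+x. ennreal (h x) \<partial>?N) ^ t"
    by (rule nn_integral_convolution_power_multiplicative)
      (auto simp: prob_space_law h_def ennreal_mult[symmetric] exp_add[symmetric] algebra_simps)
  also have "\<dots> = (\<integral>\<^sup>+\<omega>. ennreal (exp (- a * fst (S t \<omega>) - b * snd (S t \<omega>))) \<partial>M)"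
    unfolding hS nn_integral_exp_S by simp
  also have "enn2real \<dots> = expectation (\<lambda>\<omega>. exp (- a * fst (S t \<omega>) - b * snd (S t \<omega>)))"
    by (rule integral_eq_nn_integral[symmetric]) (auto simp flip: h_def)
  finally show "(\<integral>x. exp (- a * fst x - b * snd x) \<partial>convolution_power t ?N) =
      expectation (\<lambda>\<omega>. exp (- a * fst (S t \<omega>) - b * snd (S t \<omega>)))"
    by (simp add: h_def)
qed

lemma nn_integral_S_convolution_power:
  assumes "h \<in> borel_measurable borel"
  shows "(\<integral>\<^sup>+\<omega>. h (S t \<omega>) \<partial>M) = (\<integral>\<^sup>+x. h x \<partial>convolution_power t (distr M borel (S 1)))"
  unfolding law_S_convolution_power[symmetric] using assms by (subst nn_integral_distr) auto

section \<open>Moments of the claim totals\<close>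

lemma measurable_coordinate:
  fixes u :: "real \<times> real \<Rightarrow> real"
  assumes "u \<in> {fst, snd}" shows "u \<in> borel_measurable borel"
  using assms by auto

lemma nn_integral_coordinate:
  fixes u :: "real \<times> real \<Rightarrow> real"
  assumes u: "u \<in> {fst, snd}"
  shows "(\<integral>\<^sup>+\<omega>. ennreal (u (S t \<omega>)) \<partial>M) = of_nat t * (\<integral>\<^sup>+\<omega>. ennreal (u (S 1 \<omega>)) \<partial>M)"
proof -
  have [measurable]: "u \<in> borel_measurable borel" using u by (rule measurable_coordinate)
  have "(\<integral>\<^sup>+x. ennreal (u x) \<partial>convolution_power t (distr M borel (S 1))) =
      of_nat t * (\<integral>\<^sup>+x. ennreal (u x) \<partial>distr M borel (S 1))"
    by (rule nn_integral_convolution_power_additive[where P = "\<lambda>x. 0 \<le> fst x \<and> 0 \<le> snd x"])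
      (use u AE_law_nonneg[of 1] in \<open>auto simp: prob_space_law\<close>)
  then show ?thesis
    by (subst nn_integral_S_convolution_power) (simp_all add: nn_integral_distr)
qed

text \<open>Leaving \<open>u\<close> and \<open>v\<close> free covers all second-order moments at
  once: \<open>u = v\<close> gives the squares, \<open>fst\<close> with \<open>snd\<close> the mixed
  moment.\<close>

lemma nn_integral_coordinate_product:
  fixes u v :: "real \<times> real \<Rightarrow> real"
  assumes u: "u \<in> {fst, snd}" and v: "v \<in> {fst, snd}"
  shows "(\<integral>\<^sup>+\<omega>. ennreal (u (S t \<omega>) * v (S t \<omega>)) \<partial>M) =
    of_nat t * (\<integral>\<^sup>+\<omega>. ennreal (u (S 1 \<omega>) * v (S 1 \<omega>)) \<partial>M) +
    of_nat (t * (t - 1)) * (\<integral>\<^sup>+\<omega>. ennreal (u (S 1 \<omega>)) \<partial>M) * (\<integral>\<^sup>+\<omega>. ennreal (v (S 1 \<omega>)) \<partial>M)"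
proof -
  have [measurable]: "u \<in> borel_measurable borel" "v \<in> borel_measurable borel"
    using u v by (auto intro: measurable_coordinate)
  \<comment> \<open>\<open>ennreal\<close> loses the product of two negative reals, and the totals
    are known to be nonnegative only almost surely.\<close>
  have mult: "(\<integral>\<^sup>+\<omega>. ennreal (u (S s \<omega>) * v (S s \<omega>)) \<partial>M) = (\<integral>\<^sup>+\<omega>. ennreal (u (S s \<omega>)) * ennreal (v (S s \<omega>)) \<partial>M)" for s
  proof (rule nn_integral_cong_AE)
    show "AE \<omega> in M. ennreal (u (S s \<omega>) * v (S s \<omega>)) = ennreal (u (S s \<omega>)) * ennreal (v (S s \<omega>))"
      using AE_S_nonneg[of s] by eventually_elim (use u v in \<open>auto simp: ennreal_mult\<close>)
  qed
  have "(\<integral>\<^sup>+x. ennreal (u x) * ennreal (v x) \<partial>convolution_power t (distr M borel (S 1))) =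
    of_nat t * (\<integral>\<^sup>+x. ennreal (u x) * ennreal (v x) \<partial>distr M borel (S 1)) +
    of_nat (t * (t - 1)) * (\<integral>\<^sup>+x. ennreal (u x) \<partial>distr M borel (S 1)) * (\<integral>\<^sup>+x. ennreal (v x) \<partial>distr M borel (S 1))"
    by (rule nn_integral_convolution_power_biadditive[where P = "\<lambda>x. 0 \<le> fst x \<and> 0 \<le> snd x"])
      (use u v AE_law_nonneg[of 1] in \<open>auto simp: prob_space_law\<close>)
  then show ?thesis
    unfolding mult by (subst nn_integral_S_convolution_power) (simp_all add: nn_integral_distr)
qed

text \<open>Read off from the mixture at time 1. In the mixed moment only the common claims survive,
  because any other claim leaves one coordinate at 0.\<close>

lemma nn_integral_S_1_coordinates:
  "(\<integral>\<^sup>+\<omega>. ennreal (fst (S 1 \<omega>)) \<partial>M) = ennreal p1 * (\<integral>\<^sup>+\<omega>. ennreal (real_of_int (Y 1 1 \<omega>)) \<partial>M) +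
     ennreal p0 * (\<integral>\<^sup>+\<omega>. ennreal (real_of_int (Y 3 1 \<omega>)) \<partial>M)"
  "(\<integral>\<^sup>+\<omega>. ennreal (snd (S 1 \<omega>)) \<partial>M) = ennreal p2 * (\<integral>\<^sup>+\<omega>. ennreal (real_of_int (Y 2 1 \<omega>)) \<partial>M) +
     ennreal p0 * (\<integral>\<^sup>+\<omega>. ennreal (real_of_int (Y 4 1 \<omega>)) \<partial>M)"
  "(\<integral>\<^sup>+\<omega>. ennreal (fst (S 1 \<omega>) * fst (S 1 \<omega>)) \<partial>M) =
     ennreal p1 * (\<integral>\<^sup>+\<omega>. ennreal ((real_of_int (Y 1 1 \<omega>))\<^sup>2) \<partial>M) +
     ennreal p0 * (\<integral>\<^sup>+\<omega>. ennreal ((real_of_int (Y 3 1 \<omega>))\<^sup>2) \<partial>M)"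
  "(\<integral>\<^sup>+\<omega>. ennreal (snd (S 1 \<omega>) * snd (S 1 \<omega>)) \<partial>M) =
     ennreal p2 * (\<integral>\<^sup>+\<omega>. ennreal ((real_of_int (Y 2 1 \<omega>))\<^sup>2) \<partial>M) +
     ennreal p0 * (\<integral>\<^sup>+\<omega>. ennreal ((real_of_int (Y 4 1 \<omega>))\<^sup>2) \<partial>M)"
  "(\<integral>\<^sup>+\<omega>. ennreal (fst (S 1 \<omega>) * snd (S 1 \<omega>)) \<partial>M) =
     ennreal p0 * (\<integral>\<^sup>+\<omega>. ennreal (real_of_int (Y 3 1 \<omega>) * real_of_int (Y 4 1 \<omega>)) \<partial>M)"
  using nn_integral_S_1[of "\<lambda>x. ennreal (fst x)"] nn_integral_S_1[of "\<lambda>x. ennreal (snd x)"]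
    nn_integral_S_1[of "\<lambda>x. ennreal (fst x * fst x)"] nn_integral_S_1[of "\<lambda>x. ennreal (snd x * snd x)"]
    nn_integral_S_1[of "\<lambda>x. ennreal (fst x * snd x)"]
  by (simp_all add: power2_eq_square add.commute)

text \<open>\<open>has_bochner_integral\<close> delivers integrability and value together, both from
  one finite nonnegative integral.\<close>

lemma has_bochner_integral_coordinate:
  fixes u :: "real \<times> real \<Rightarrow> real"
  assumes u: "u \<in> {fst, snd}" and m: "(\<integral>\<^sup>+\<omega>. ennreal (u (S 1 \<omega>)) \<partial>M) = ennreal m" "m \<ge> 0"
  shows "has_bochner_integral M (\<lambda>\<omega>. u (S t \<omega>)) (t * m)"
proof (rule has_bochner_integral_nn_integral)
  show "(\<lambda>\<omega>. u (S t \<omega>)) \<in> borel_measurable M"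
    by (rule measurable_compose[OF measurable_S measurable_coordinate[OF u]])
  show "AE \<omega> in M. 0 \<le> u (S t \<omega>)"
    using AE_S_nonneg[of t] u by auto
  show "(\<integral>\<^sup>+\<omega>. ennreal (u (S t \<omega>)) \<partial>M) = ennreal (t * m)"
    using m(2) by (simp add: nn_integral_coordinate[OF u, of t] m(1) ennreal_mult ennreal_of_nat_eq_real_of_nat del: One_nat_def)
qed (use m in simp)

lemma has_bochner_integral_coordinate_product:
  fixes u v :: "real \<times> real \<Rightarrow> real"
  assumes u: "u \<in> {fst, snd}" and m: "(\<integral>\<^sup>+\<omega>. ennreal (u (S 1 \<omega>)) \<partial>M) = ennreal m" "m \<ge> 0"
    and v: "v \<in> {fst, snd}" and n: "(\<integral>\<^sup>+\<omega>. ennreal (v (S 1 \<omega>)) \<partial>M) = ennreal n" "n \<ge> 0"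
    and c: "(\<integral>\<^sup>+\<omega>. ennreal (u (S 1 \<omega>) * v (S 1 \<omega>)) \<partial>M) = ennreal c" "c \<ge> 0"
  shows "has_bochner_integral M (\<lambda>\<omega>. u (S t \<omega>) * v (S t \<omega>)) (t * c + t * (real t - 1) * m * n)"
proof (rule has_bochner_integral_nn_integral)
  \<comment> \<open>At \<open>t = 0\<close> the real \<open>t - 1\<close> is -1 and the natural one
    is 0; the factor \<open>t\<close> makes the two sides agree.\<close>
  have t: "t * (real t - 1) = real (t * (t - 1))"
    by (cases t) (simp_all add: algebra_simps)
  show "(\<lambda>\<omega>. u (S t \<omega>) * v (S t \<omega>)) \<in> borel_measurable M"
    by (intro borel_measurable_times measurable_compose[OF measurable_S measurable_coordinate] u v)
  show "AE \<omega> in M. 0 \<le> u (S t \<omega>) * v (S t \<omega>)"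
    using AE_S_nonneg[of t] u v by auto
  show "(\<integral>\<^sup>+\<omega>. ennreal (u (S t \<omega>) * v (S t \<omega>)) \<partial>M) = ennreal (t * c + t * (real t - 1) * m * n)"
    unfolding t using m(2) n(2) c(2)
    by (simp add: nn_integral_coordinate_product[OF u v, of t] m(1) n(1) c(1) ennreal_mult
        ennreal_of_nat_eq_real_of_nat del: of_nat_mult One_nat_def)
  show "0 \<le> t * c + t * (real t - 1) * m * n"
    unfolding t using m(2) n(2) c(2) by simp
qed

lemma nn_integral_first_claim:
  assumes "k \<in> {1..4}" "integrable M (\<lambda>\<omega>. real_of_int (Y k 1 \<omega>))"
  shows "(\<integral>\<^sup>+\<omega>. ennreal (real_of_int (Y k 1 \<omega>)) \<partial>M) = ennreal (mean k)" "mean k \<ge> 0"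
  using assms AE_first_claim_nonneg[of k] by (auto intro!: nn_integral_eq_integral integral_nonneg_AE)

context
  assumes integrable: "\<forall>k\<in>{1..4}. integrable M (\<lambda>\<omega>. real_of_int (Y k 1 \<omega>))"
begin

lemma nn_integral_S_1_eq_mean:
  "(\<integral>\<^sup>+\<omega>. ennreal (fst (S 1 \<omega>)) \<partial>M) = ennreal (p1 * mean 1 + p0 * mean 3)" "p1 * mean 1 + p0 * mean 3 \<ge> 0"
  "(\<integral>\<^sup>+\<omega>. ennreal (snd (S 1 \<omega>)) \<partial>M) = ennreal (p2 * mean 2 + p0 * mean 4)" "p2 * mean 2 + p0 * mean 4 \<ge> 0"
proof -
  note Y = nn_integral_first_claim[of 1] nn_integral_first_claim[of 2] nn_integral_first_claim[of 3]
    nn_integral_first_claim[of 4]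
  show "(\<integral>\<^sup>+\<omega>. ennreal (fst (S 1 \<omega>)) \<partial>M) = ennreal (p1 * mean 1 + p0 * mean 3)" "p1 * mean 1 + p0 * mean 3 \<ge> 0"
    "(\<integral>\<^sup>+\<omega>. ennreal (snd (S 1 \<omega>)) \<partial>M) = ennreal (p2 * mean 2 + p0 * mean 4)" "p2 * mean 2 + p0 * mean 4 \<ge> 0"
    using Y integrable p_nonneg unfolding nn_integral_S_1_coordinates by (simp_all add: ennreal_mult)
qed

lemma has_bochner_integral_S:
  "has_bochner_integral M (\<lambda>\<omega>. fst (S t \<omega>)) (t * (p1 * mean 1 + p0 * mean 3))"
  "has_bochner_integral M (\<lambda>\<omega>. snd (S t \<omega>)) (t * (p2 * mean 2 + p0 * mean 4))"
  using nn_integral_S_1_eq_mean by (auto intro!: has_bochner_integral_coordinate)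

text \<open>\<open>Y 3 1\<close> and \<open>Y 4 1\<close> may be dependent, so integrability of
  their product does not follow from that of the factors and is assumed separately.\<close>

lemma has_bochner_integral_S_product:
  assumes "integrable M (\<lambda>\<omega>. real_of_int (Y 3 1 \<omega>) * real_of_int (Y 4 1 \<omega>))"
  shows "has_bochner_integral M (\<lambda>\<omega>. fst (S t \<omega>) * snd (S t \<omega>))
    (t * p0 * cross_moment + t * (real t - 1) * (p1 * mean 1 + p0 * mean 3) * (p2 * mean 2 + p0 * mean 4))"
proof -
  have nonneg: "AE \<omega> in M. 0 \<le> real_of_int (Y 3 1 \<omega>) * real_of_int (Y 4 1 \<omega>)"
    using AE_first_claims_nonneg by eventually_elim (auto intro: mult_nonneg_nonneg)
  then have "(\<integral>\<^sup>+\<omega>. ennreal (real_of_int (Y 3 1 \<omega>) * real_of_int (Y 4 1 \<omega>)) \<partial>M) = ennreal cross_moment"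
    using assms by (intro nn_integral_eq_integral)
  moreover have c: "cross_moment \<ge> 0"
    using nonneg by (rule integral_nonneg_AE)
  ultimately have "(\<integral>\<^sup>+\<omega>. ennreal (fst (S 1 \<omega>) * snd (S 1 \<omega>)) \<partial>M) = ennreal (p0 * cross_moment)"
    unfolding nn_integral_S_1_coordinates using p_nonneg by (simp add: ennreal_mult)
  from has_bochner_integral_coordinate_product[OF _ nn_integral_S_1_eq_mean(1,2) _ nn_integral_S_1_eq_mean(3,4) this]
  show ?thesis using c p_nonneg by (simp add: mult.assoc)
qed

lemma covariance_S:
  assumes "integrable M (\<lambda>\<omega>. real_of_int (Y 3 1 \<omega>) * real_of_int (Y 4 1 \<omega>))"
  shows "covariance (\<lambda>\<omega>. fst (S t \<omega>)) (\<lambda>\<omega>. snd (S t \<omega>)) =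
    t * (p0 * cross_moment - (p1 * mean 1 + p0 * mean 3) * (p2 * mean 2 + p0 * mean 4))"
proof -
  note X = has_bochner_integral_S(1)[of t, THEN has_bochner_integral_iff[THEN iffD1]]
    and Z = has_bochner_integral_S(2)[of t, THEN has_bochner_integral_iff[THEN iffD1]]
    and XZ = has_bochner_integral_S_product[OF assms, of t, THEN has_bochner_integral_iff[THEN iffD1]]
  have "covariance (\<lambda>\<omega>. fst (S t \<omega>)) (\<lambda>\<omega>. snd (S t \<omega>)) =
      expectation (\<lambda>\<omega>. fst (S t \<omega>) * snd (S t \<omega>)) - expectation (\<lambda>\<omega>. fst (S t \<omega>)) * expectation (\<lambda>\<omega>. snd (S t \<omega>))"
    unfolding covariance_def using X Z XZ by (simp add: algebra_simps prob_space)
  then show ?thesis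
    using X Z XZ by (simp add: algebra_simps)
qed

end

context
  assumes square_integrable: "\<forall>k\<in>{1..4}. integrable M (\<lambda>\<omega>. (real_of_int (Y k 1 \<omega>))\<^sup>2)"
begin

lemma integrable_of_square: "\<forall>k\<in>{1..4}. integrable M (\<lambda>\<omega>. real_of_int (Y k 1 \<omega>))"
  using square_integrable measurable_first_claim by (blast intro: square_integrable_imp_integrable)

text \<open>Follows from \<open>2 * \<bar>x * y\<bar> \<le> x\<^sup>2 + y\<^sup>2\<close>. It makes
  the covariance formula available under second moment conditions.\<close>

lemma integrable_cross: "integrable M (\<lambda>\<omega>. real_of_int (Y 3 1 \<omega>) * real_of_int (Y 4 1 \<omega>))"
proof (rule Bochner_Integration.integrable_bound)
  show "integrable M (\<lambda>\<omega>. (real_of_int (Y 3 1 \<omega>))\<^sup>2 + (real_of_int (Y 4 1 \<omega>))\<^sup>2)"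
    using square_integrable by (intro Bochner_Integration.integrable_add) auto
  show "(\<lambda>\<omega>. real_of_int (Y 3 1 \<omega>) * real_of_int (Y 4 1 \<omega>)) \<in> borel_measurable M"
    by (intro borel_measurable_times measurable_first_claim) auto
  have "\<bar>x * y\<bar> \<le> x\<^sup>2 + y\<^sup>2" for x y :: real
  proof -
    have "2 * (\<bar>x\<bar> * \<bar>y\<bar>) \<le> x\<^sup>2 + y\<^sup>2"
      using sum_squares_bound[of "\<bar>x\<bar>" "\<bar>y\<bar>"] by (simp add: mult.assoc)
    moreover have "0 \<le> \<bar>x\<bar> * \<bar>y\<bar>" by simp
    ultimately show ?thesis unfolding abs_mult by linarith
  qed
  then show "AE \<omega> in M. norm (real_of_int (Y 3 1 \<omega>) * real_of_int (Y 4 1 \<omega>)) \<le>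
      norm ((real_of_int (Y 3 1 \<omega>))\<^sup>2 + (real_of_int (Y 4 1 \<omega>))\<^sup>2)"
    by simp
qed

lemma has_bochner_integral_S_square:
  "has_bochner_integral M (\<lambda>\<omega>. (fst (S t \<omega>))\<^sup>2)
     (t * (p1 * second_moment 1 + p0 * second_moment 3) + t * (real t - 1) * (p1 * mean 1 + p0 * mean 3)\<^sup>2)"
  "has_bochner_integral M (\<lambda>\<omega>. (snd (S t \<omega>))\<^sup>2)
     (t * (p2 * second_moment 2 + p0 * second_moment 4) + t * (real t - 1) * (p2 * mean 2 + p0 * mean 4)\<^sup>2)"
proof -
  have sq: "(\<integral>\<^sup>+\<omega>. ennreal ((real_of_int (Y k 1 \<omega>))\<^sup>2) \<partial>M) = ennreal (second_moment k)" "second_moment k \<ge> 0"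
    if "k \<in> {1..4}" for k
    using square_integrable that by (auto intro!: nn_integral_eq_integral)
  note Y = sq[of 1] sq[of 2] sq[of 3] sq[of 4]
  have "(\<integral>\<^sup>+\<omega>. ennreal (fst (S 1 \<omega>) * fst (S 1 \<omega>)) \<partial>M) = ennreal (p1 * second_moment 1 + p0 * second_moment 3)"
    "(\<integral>\<^sup>+\<omega>. ennreal (snd (S 1 \<omega>) * snd (S 1 \<omega>)) \<partial>M) = ennreal (p2 * second_moment 2 + p0 * second_moment 4)"
    "0 \<le> p1 * second_moment 1 + p0 * second_moment 3" "0 \<le> p2 * second_moment 2 + p0 * second_moment 4"
    using Y p_nonneg unfolding nn_integral_S_1_coordinates by (simp_all add: ennreal_mult)
  note m = this nn_integral_S_1_eq_mean[OF integrable_of_square]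
  show "has_bochner_integral M (\<lambda>\<omega>. (fst (S t \<omega>))\<^sup>2)
     (t * (p1 * second_moment 1 + p0 * second_moment 3) + t * (real t - 1) * (p1 * mean 1 + p0 * mean 3)\<^sup>2)"
    using has_bochner_integral_coordinate_product[OF _ m(5,6) _ m(5,6) m(1,3), of t]
    by (simp add: power2_eq_square mult.assoc)
  show "has_bochner_integral M (\<lambda>\<omega>. (snd (S t \<omega>))\<^sup>2)
     (t * (p2 * second_moment 2 + p0 * second_moment 4) + t * (real t - 1) * (p2 * mean 2 + p0 * mean 4)\<^sup>2)"
    using has_bochner_integral_coordinate_product[OF _ m(7,8) _ m(7,8) m(2,4), of t]
    by (simp add: power2_eq_square mult.assoc)
qed

text \<open>With \<open>m\<close> and \<open>s\<close> the first and second moments at time 1,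
  \<open>t * s + t * (t - 1) * m\<^sup>2 - (t * m)\<^sup>2\<close> collapses to
  \<open>t * (s - m\<^sup>2)\<close>, as it must for a sum of \<open>t\<close> independent
  copies.\<close>

lemma variance_S:
  "variance (\<lambda>\<omega>. fst (S t \<omega>)) =
     t * (p1 * second_moment 1 + p0 * second_moment 3 - (p1 * mean 1 + p0 * mean 3)\<^sup>2)"
  "variance (\<lambda>\<omega>. snd (S t \<omega>)) =
     t * (p2 * second_moment 2 + p0 * second_moment 4 - (p2 * mean 2 + p0 * mean 4)\<^sup>2)"
proof -
  have var: "variance X = real t * (s - m\<^sup>2)"
    if "has_bochner_integral M X (t * m)" "has_bochner_integral M (\<lambda>\<omega>. (X \<omega>)\<^sup>2) (t * s + t * (real t - 1) * m\<^sup>2)"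
    for X :: "'a \<Rightarrow> real" and m s :: real
  proof -
    have "variance X = expectation (\<lambda>\<omega>. (X \<omega>)\<^sup>2) - (expectation X)\<^sup>2"
      using that by (intro variance_eq) (auto simp: has_bochner_integral_iff)
    also have "\<dots> = t * s + t * (real t - 1) * m\<^sup>2 - (t * m)\<^sup>2"
      using that by (simp add: has_bochner_integral_iff)
    also have "\<dots> = t * (s - m\<^sup>2)"
      by (simp add: power2_eq_square algebra_simps)
    finally show ?thesis .
  qed
  show "variance (\<lambda>\<omega>. fst (S t \<omega>)) =
     t * (p1 * second_moment 1 + p0 * second_moment 3 - (p1 * mean 1 + p0 * mean 3)\<^sup>2)"
    by (intro var has_bochner_integral_S has_bochner_integral_S_square integrable_of_square)
  show "variance (\<lambda>\<omega>. snd (S t \<omega>)) =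
     t * (p2 * second_moment 2 + p0 * second_moment 4 - (p2 * mean 2 + p0 * mean 4)\<^sup>2)"
    by (intro var has_bochner_integral_S has_bochner_integral_S_square integrable_of_square)
qed

text \<open>Covariance and both variances carry the factor \<open>t\<close>, which cancels when it
  is nonzero. At \<open>t = 0\<close> the totals are almost surely 0 and the quotient is 0 by the
  convention for division by zero, hence \<open>t \<ge> 1\<close>. If a variance vanishes at
  \<open>t \<ge> 1\<close>, both sides are 0 by the same convention.\<close>

lemma correlation_S:
  assumes "t \<ge> 1"
  shows "correlation (\<lambda>\<omega>. fst (S t \<omega>)) (\<lambda>\<omega>. snd (S t \<omega>)) =
    (p0 * cross_moment - (p1 * mean 1 + p0 * mean 3) * (p2 * mean 2 + p0 * mean 4)) /
    sqrt ((p1 * second_moment 1 + p0 * second_moment 3 - (p1 * mean 1 + p0 * mean 3)\<^sup>2) *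
          (p2 * second_moment 2 + p0 * second_moment 4 - (p2 * mean 2 + p0 * mean 4)\<^sup>2))"
proof -
  have "sqrt (t * v * (t * w)) = t * sqrt (v * w)" for v w :: real
    using real_sqrt_mult[of "real t * real t" "v * w"] by (simp add: mult_ac)
  then show ?thesis
    using assms
    by (simp only: correlation_def variance_S covariance_S[OF integrable_of_square integrable_cross]) simp
qed

end

text \<open>The mixed moment in [0, \<infinity>], with 0 times \<infinity> read as 0; it holds
  whether or not the moments are finite.\<close>

lemma nn_integral_S_product:
  "(\<integral>\<^sup>+\<omega>. ennreal (fst (S t \<omega>) * snd (S t \<omega>)) \<partial>M) =
    ennreal (t * p0) * (\<integral>\<^sup>+\<omega>. ennreal (real_of_int (Y 3 1 \<omega>) * real_of_int (Y 4 1 \<omega>)) \<partial>M) +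
    ennreal (t * (real t - 1)) *
      (ennreal p1 * (\<integral>\<^sup>+\<omega>. ennreal (real_of_int (Y 1 1 \<omega>)) \<partial>M) +
       ennreal p0 * (\<integral>\<^sup>+\<omega>. ennreal (real_of_int (Y 3 1 \<omega>)) \<partial>M)) *
      (ennreal p2 * (\<integral>\<^sup>+\<omega>. ennreal (real_of_int (Y 2 1 \<omega>)) \<partial>M) +
       ennreal p0 * (\<integral>\<^sup>+\<omega>. ennreal (real_of_int (Y 4 1 \<omega>)) \<partial>M))"
proof -
  have "t * (real t - 1) = real (t * (t - 1))"
    by (cases t) (simp_all add: algebra_simps)
  then have t: "ennreal (t * (real t - 1)) = of_nat (t * (t - 1))"
    by (simp only: ennreal_of_nat_eq_real_of_nat)
  have "ennreal (t * p0) = of_nat t * ennreal p0"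
    using p_nonneg by (simp add: ennreal_mult ennreal_of_nat_eq_real_of_nat)
  then show ?thesis
    using nn_integral_coordinate_product[of fst snd t]
    unfolding t nn_integral_S_1_coordinates by (simp only: insertI1 insertI2 mult.assoc)
qed

end

text \<open>That the transform determines the law is rendered as uniqueness among probability
  measures carried by the closed quadrant. Item (iii), which comes without moment conditions in
  words, appears twice: as an identity in [0, \<infinity>] and, under integrability, for real
  expectations. Constancy of the correlation is asserted for times at least 1.\<close>

theorem corollary3:
  fixes M :: "'a measure"
    and p0 p1 p2 :: real
    and B0 B1 B2 :: "nat \<Rightarrow> 'a \<Rightarrow> nat"
    and Y :: "nat \<Rightarrow> nat \<Rightarrow> 'a \<Rightarrow> int"
    and S1 S2 :: "nat \<Rightarrow> 'a \<Rightarrow> real"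
    and t :: nat
  assumes "prob_space M"
    and "p0 \<ge> 0" and "p1 \<ge> 0" and "p2 \<ge> 0" and "p0 + p1 + p2 \<le> 1"
    and "prob_space.multinomial_process M p0 p1 p2 B0 B1 B2"
    and "prob_space.claim_sizes M Y"
    and "prob_space.claims_independent M B0 B1 B2 Y"
    and S1: "\<And>t \<omega>. S1 t \<omega> = (\<Sum>i=0..B1 t \<omega>. real_of_int (Y 1 i \<omega>)) + (\<Sum>i=0..B0 t \<omega>. real_of_int (Y 3 i \<omega>))"
    and S2: "\<And>t \<omega>. S2 t \<omega> = (\<Sum>i=0..B2 t \<omega>. real_of_int (Y 2 i \<omega>)) + (\<Sum>i=0..B0 t \<omega>. real_of_int (Y 4 i \<omega>))"
  shows "(\<forall>z1\<ge>(0::real). \<forall>z2\<ge>(0::real).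
        prob_space.expectation M (\<lambda>\<omega>. exp (- z1 * S1 t \<omega> - z2 * S2 t \<omega>)) =
          (1 - (p0 + p1 + p2)
           + p1 * prob_space.expectation M (\<lambda>\<omega>. exp (- z1 * real_of_int (Y 1 1 \<omega>)))
           + p0 * prob_space.expectation M (\<lambda>\<omega>. exp (- (z1 * real_of_int (Y 3 1 \<omega>) + z2 * real_of_int (Y 4 1 \<omega>))))
           + p2 * prob_space.expectation M (\<lambda>\<omega>. exp (- z2 * real_of_int (Y 2 1 \<omega>)))) ^ t)
    \<and> (\<forall>L :: (real \<times> real) measure.
        prob_space L \<and> sets L = sets borel \<and> (AE x in L. fst x \<ge> 0 \<and> snd x \<ge> 0) \<and>
        (\<forall>z1\<ge>(0::real). \<forall>z2\<ge>(0::real).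
          prob_space.expectation L (\<lambda>x. exp (- z1 * fst x - z2 * snd x)) =
          (1 - (p0 + p1 + p2)
           + p1 * prob_space.expectation M (\<lambda>\<omega>. exp (- z1 * real_of_int (Y 1 1 \<omega>)))
           + p0 * prob_space.expectation M (\<lambda>\<omega>. exp (- (z1 * real_of_int (Y 3 1 \<omega>) + z2 * real_of_int (Y 4 1 \<omega>))))
           + p2 * prob_space.expectation M (\<lambda>\<omega>. exp (- z2 * real_of_int (Y 2 1 \<omega>)))) ^ t)
        \<longrightarrow> L = distr M borel (\<lambda>\<omega>. (S1 t \<omega>, S2 t \<omega>)))
    \<and> ((\<forall>k\<in>{1..4}. integrable M (\<lambda>\<omega>. real_of_int (Y k 1 \<omega>))) \<longrightarrow>
        integrable M (S1 t) \<and> integrable M (S2 t) \<and>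
        prob_space.expectation M (S1 t) = t *
           (p1 * prob_space.expectation M (\<lambda>\<omega>. real_of_int (Y 1 1 \<omega>)) +
            p0 * prob_space.expectation M (\<lambda>\<omega>. real_of_int (Y 3 1 \<omega>))) \<and>
        prob_space.expectation M (S2 t) = t *
           (p2 * prob_space.expectation M (\<lambda>\<omega>. real_of_int (Y 2 1 \<omega>)) +
            p0 * prob_space.expectation M (\<lambda>\<omega>. real_of_int (Y 4 1 \<omega>))))
    \<and> ((\<forall>k\<in>{1..4}. integrable M (\<lambda>\<omega>. (real_of_int (Y k 1 \<omega>))\<^sup>2)) \<longrightarrow>
        integrable M (\<lambda>\<omega>. (S1 t \<omega>)\<^sup>2) \<and> integrable M (\<lambda>\<omega>. (S2 t \<omega>)\<^sup>2) \<and>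
        prob_space.variance M (S1 t) = t *
           (p1 * prob_space.expectation M (\<lambda>\<omega>. (real_of_int (Y 1 1 \<omega>))\<^sup>2) +
            p0 * prob_space.expectation M (\<lambda>\<omega>. (real_of_int (Y 3 1 \<omega>))\<^sup>2) -
            (p1 * prob_space.expectation M (\<lambda>\<omega>. real_of_int (Y 1 1 \<omega>)) +
            p0 * prob_space.expectation M (\<lambda>\<omega>. real_of_int (Y 3 1 \<omega>)))\<^sup>2) \<and>
        prob_space.variance M (S2 t) = t *
           (p2 * prob_space.expectation M (\<lambda>\<omega>. (real_of_int (Y 2 1 \<omega>))\<^sup>2) +
            p0 * prob_space.expectation M (\<lambda>\<omega>. (real_of_int (Y 4 1 \<omega>))\<^sup>2) -
            (p2 * prob_space.expectation M (\<lambda>\<omega>. real_of_int (Y 2 1 \<omega>)) +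
            p0 * prob_space.expectation M (\<lambda>\<omega>. real_of_int (Y 4 1 \<omega>)))\<^sup>2))
    \<and> ((\<integral>\<^sup>+\<omega>. ennreal (S1 t \<omega> * S2 t \<omega>) \<partial>M) =
          ennreal (t * p0) * (\<integral>\<^sup>+\<omega>. ennreal (real_of_int (Y 3 1 \<omega>) * real_of_int (Y 4 1 \<omega>)) \<partial>M) +
          ennreal (t * (real t - 1)) *
            (ennreal p1 * (\<integral>\<^sup>+\<omega>. ennreal (real_of_int (Y 1 1 \<omega>)) \<partial>M) +
             ennreal p0 * (\<integral>\<^sup>+\<omega>. ennreal (real_of_int (Y 3 1 \<omega>)) \<partial>M)) *
            (ennreal p2 * (\<integral>\<^sup>+\<omega>. ennreal (real_of_int (Y 2 1 \<omega>)) \<partial>M) +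
             ennreal p0 * (\<integral>\<^sup>+\<omega>. ennreal (real_of_int (Y 4 1 \<omega>)) \<partial>M)))
    \<and> ((\<forall>k\<in>{1..4}. integrable M (\<lambda>\<omega>. real_of_int (Y k 1 \<omega>))) \<and>
        integrable M (\<lambda>\<omega>. real_of_int (Y 3 1 \<omega>) * real_of_int (Y 4 1 \<omega>)) \<longrightarrow>
        integrable M (\<lambda>\<omega>. S1 t \<omega> * S2 t \<omega>) \<and>
        prob_space.expectation M (\<lambda>\<omega>. S1 t \<omega> * S2 t \<omega>) =
          t * p0 * prob_space.expectation M (\<lambda>\<omega>. real_of_int (Y 3 1 \<omega>) * real_of_int (Y 4 1 \<omega>)) +
          t * (real t - 1) *
           (p1 * prob_space.expectation M (\<lambda>\<omega>. real_of_int (Y 1 1 \<omega>)) +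
            p0 * prob_space.expectation M (\<lambda>\<omega>. real_of_int (Y 3 1 \<omega>))) *
           (p2 * prob_space.expectation M (\<lambda>\<omega>. real_of_int (Y 2 1 \<omega>)) +
            p0 * prob_space.expectation M (\<lambda>\<omega>. real_of_int (Y 4 1 \<omega>))))
    \<and> ((\<forall>k\<in>{1..4}. integrable M (\<lambda>\<omega>. real_of_int (Y k 1 \<omega>))) \<and>
        integrable M (\<lambda>\<omega>. real_of_int (Y 3 1 \<omega>) * real_of_int (Y 4 1 \<omega>)) \<longrightarrow>
        prob_space.covariance M (S1 t) (S2 t) =
          t * (p0 * prob_space.expectation M (\<lambda>\<omega>. real_of_int (Y 3 1 \<omega>) * real_of_int (Y 4 1 \<omega>)) -
           (p1 * prob_space.expectation M (\<lambda>\<omega>. real_of_int (Y 1 1 \<omega>)) +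
            p0 * prob_space.expectation M (\<lambda>\<omega>. real_of_int (Y 3 1 \<omega>))) *
           (p2 * prob_space.expectation M (\<lambda>\<omega>. real_of_int (Y 2 1 \<omega>)) +
            p0 * prob_space.expectation M (\<lambda>\<omega>. real_of_int (Y 4 1 \<omega>)))))
    \<and> ((\<forall>k\<in>{1..4}. integrable M (\<lambda>\<omega>. (real_of_int (Y k 1 \<omega>))\<^sup>2)) \<and> t \<ge> 1 \<longrightarrow>
        (\<forall>s\<ge>1. prob_space.correlation M (S1 s) (S2 s) = prob_space.correlation M (S1 t) (S2 t)) \<and>
        prob_space.correlation M (S1 t) (S2 t) =
          (p0 * prob_space.expectation M (\<lambda>\<omega>. real_of_int (Y 3 1 \<omega>) * real_of_int (Y 4 1 \<omega>)) -
           (p1 * prob_space.expectation M (\<lambda>\<omega>. real_of_int (Y 1 1 \<omega>)) +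
            p0 * prob_space.expectation M (\<lambda>\<omega>. real_of_int (Y 3 1 \<omega>))) *
           (p2 * prob_space.expectation M (\<lambda>\<omega>. real_of_int (Y 2 1 \<omega>)) +
            p0 * prob_space.expectation M (\<lambda>\<omega>. real_of_int (Y 4 1 \<omega>)))) /
          sqrt ((p1 * prob_space.expectation M (\<lambda>\<omega>. (real_of_int (Y 1 1 \<omega>))\<^sup>2) +
            p0 * prob_space.expectation M (\<lambda>\<omega>. (real_of_int (Y 3 1 \<omega>))\<^sup>2) -
            (p1 * prob_space.expectation M (\<lambda>\<omega>. real_of_int (Y 1 1 \<omega>)) +
            p0 * prob_space.expectation M (\<lambda>\<omega>. real_of_int (Y 3 1 \<omega>)))\<^sup>2) *
           (p2 * prob_space.expectation M (\<lambda>\<omega>. (real_of_int (Y 2 1 \<omega>))\<^sup>2) +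
            p0 * prob_space.expectation M (\<lambda>\<omega>. (real_of_int (Y 4 1 \<omega>))\<^sup>2) -
            (p2 * prob_space.expectation M (\<lambda>\<omega>. real_of_int (Y 2 1 \<omega>)) +
            p0 * prob_space.expectation M (\<lambda>\<omega>. real_of_int (Y 4 1 \<omega>)))\<^sup>2)))"
proof -
  interpret prob_space M by fact
  interpret compound_multinomial M p0 p1 p2 B0 B1 B2 Y
    using assms by unfold_locales
  \<comment> \<open>With both totals written as components of \<open>S t\<close>,
    \<open>prod.collapse\<close> turns the law of the pair into the law of
    \<open>S t\<close>.\<close>
  have eqs: "S1 = (\<lambda>t \<omega>. fst (S t \<omega>))" "S2 = (\<lambda>t \<omega>. snd (S t \<omega>))"
    by (simp_all add: fun_eq_iff S1 S2 S_def counts_def claim_sums_def)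
  note S = has_bochner_integral_S[THEN has_bochner_integral_iff[THEN iffD1]]
    and S_square = has_bochner_integral_S_square[THEN has_bochner_integral_iff[THEN iffD1]]
    and S_product = has_bochner_integral_S_product[THEN has_bochner_integral_iff[THEN iffD1]]
  show ?thesis
    unfolding eqs prod.collapse
  proof (intro conjI allI impI, goal_cases)
    case (1 z1 z2)
    then show ?case by (rule expectation_exp_S)
  next
    case (2 L)
    then show ?case using law_unique[of L t] expectation_exp_S[of _ _ t] by auto
  next
    case 3
    then show ?case using S(1)[of t] by blast
  next
    case 4
    then show ?case using S(2)[of t] by blast
  next
    case 5
    then show ?case using S(1)[of t] by blast
  next
    case 6
    then show ?case using S(2)[of t] by blast
  next
    case 7
    then show ?case using S_square(1)[of t] by blast
  next
    case 8
    then show ?case using S_square(2)[of t] by blast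
  next
    case 9
    then show ?case by (rule variance_S(1))
  next
    case 10
    then show ?case by (rule variance_S(2))
  next
    case 11
    show ?case by (rule nn_integral_S_product)
  next
    case 12
    then show ?case using S_product[of t] by blast
  next
    case 13
    then show ?case using S_product[of t] by blast
  next
    case 14
    then show ?case using covariance_S[of t] by blast
  next
    case (15 s)
    then show ?case using correlation_S[of s] correlation_S[of t] by simp
  next
    case 16
    then show ?case using correlation_S[of t] by simp
  qed
qed

end
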